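(* Assume that $u\in H^1_+\cap L^2_s$ for some $s>\frac12$. Then for every $k\in\mathbb{C}^+\cup\mathbb{C}^-\cup\big((-\infty,0)\setminus\sigma_{pp}(\mathbb{L}_u)\big)$ there exists a unique solution $\phi\in L^\infty_{-s}$ of $$\phi=1+G_k*\big(u\,\Pi(\overline u\phi)\big),$$ and this solution is given by $\phi\equiv1$.
   Context: All functions are complex valued on $\mathbb{R}$. $\hat f(\xi)=\int_{\mathbb{R}} f(x)e^{-ix\xi}\,dx$. $H^\sigma_+=\{f\in H^\sigma(\mathbb{R};\mathbb{C}):\mathrm{supp}\,\hat f\subset[0,+\infty)\}$ for $\sigma\ge0$, $L^2_+=H^0_+$. $\Pi:L^2\to L^2$ is the Cauchy-Szegő projector, $\widehat{\Pi f}(\xi)=\mathbf{1}_{\xi\ge0}\hat f(\xi)$. $L^2_s=\{f:\int_{\mathbb{R}}|f(x)|^2(1+x^2)^s\,dx<\infty\}$, $L^\infty_{-s}=\{f:\|(1+x^2)^{-s/2}f\|_{L^\infty}<\infty\}$. $\mathbb{C}^\pm=\{z:\pm\mathrm{Im}\,z>0\}$. For $k\in\mathbb{C}\setminus[0,+\infty)$, $G_k\in L^2$ is the inverse Fourier transform of $\xi\mapsto\mathbf{1}_{\xi\ge0}/(\xi-k)$, i.e. $G_k(x)=\frac1{2\pi}\int_0^\infty\frac{e^{ix\xi}}{\xi-k}\,d\xi$. $\mathbb{L}_uh=-i\partial_xh-u\Pi(\overline uh)$ is the self-adjoint Lax operator on $L^2_+$ with domain $H^1_+$, and $\sigma_{pp}(\mathbb{L}_u)$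 is its set of eigenvalues. *)

theory Defs
  imports "HOL-Analysis.Analysis"
begin

text \<open>
  Elements of the function spaces below are represented by Borel functions, and equality of
  elements is equality almost everywhere with respect to Lebesgue measure.
\<close>

definition L2 :: "(real \<Rightarrow> complex) set" where
  "L2 = {f \<in> borel_measurable lborel. integrable lborel (\<lambda>x. (cmod (f x))\<^sup>2)}"

definition L2_weighted :: "real \<Rightarrow> (real \<Rightarrow> complex) set" where
  "L2_weighted s =
     {f \<in> borel_measurable lborel. integrable lborel (\<lambda>x. (cmod (f x))\<^sup>2 * (1 + x\<^sup>2) powr s)}"

text \<open>The parameter is the weight exponent, so that the weight is \<open>(1 + x\<^sup>2)\<^bsup>r/2\<^esup>\<close>.\<close>

definition Linf_weighted :: "real \<Rightarrow> (real \<Rightarrow> complex) set" where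
  "Linf_weighted r =
     {f \<in> borel_measurable lborel. \<exists>C. AE x in lborel. cmod ((1 + x\<^sup>2) powr (r / 2) * f x) \<le> C}"

definition fourier_trunc :: "real \<Rightarrow> (real \<Rightarrow> complex) \<Rightarrow> real \<Rightarrow> complex" where
  "fourier_trunc R f \<xi> = (LINT x:{-R..R}|lborel. f x * exp (- (\<i> * of_real (x * \<xi>))))"

text \<open>
  The Fourier transform on \<open>L2\<close>: the limit in mean square, as \<open>R \<rightarrow> \<infinity>\<close>, of the integrals over
  \<open>[-R, R]\<close>. The distance is a nonnegative integral with values in the extended reals, so
  the condition is not met by default when a difference fails to be square integrable.
  The choice operator picks a representative of the limit class.
\<close>

definition fourier :: "(real \<Rightarrow> complex) \<Rightarrow> real \<Rightarrow> complex" where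
  "fourier f = (SOME g. g \<in> L2 \<and>
     ((\<lambda>R. \<integral>\<^sup>+ \<xi>. ennreal ((cmod (g \<xi> - fourier_trunc R f \<xi>))\<^sup>2) \<partial>lborel) \<longlongrightarrow> 0) at_top)"

definition inv_fourier :: "(real \<Rightarrow> complex) \<Rightarrow> real \<Rightarrow> complex" where
  "inv_fourier g x = 1 / (2 * of_real pi) * fourier g (- x)"

text \<open>Support of a function as a distribution: complement of the largest open null set.\<close>

definition ess_support :: "(real \<Rightarrow> complex) \<Rightarrow> real set" where
  "ess_support f = - \<Union>{U. open U \<and> (AE x in lborel. x \<in> U \<longrightarrow> f x = 0)}"

definition H_space :: "real \<Rightarrow> (real \<Rightarrow> complex) set" where
  "H_space \<sigma> = {f \<in> L2. integrable lborel (\<lambda>\<xi>. (1 + \<xi>\<^sup>2) powr \<sigma> * (cmod (fourier f \<xi>))\<^sup>2)}"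

definition H_plus :: "real \<Rightarrow> (real \<Rightarrow> complex) set" where
  "H_plus \<sigma> = {f \<in> H_space \<sigma>. ess_support (fourier f) \<subseteq> {0..}}"

definition szego :: "(real \<Rightarrow> complex) \<Rightarrow> real \<Rightarrow> complex" where
  "szego f = inv_fourier (\<lambda>\<xi>. of_real (indicator {0..} \<xi>) * fourier f \<xi>)"

definition G :: "complex \<Rightarrow> real \<Rightarrow> complex" where
  "G k = inv_fourier (\<lambda>\<xi>. of_real (indicator {0..} \<xi>) / (of_real \<xi> - k))"

definition convolution :: "(real \<Rightarrow> complex) \<Rightarrow> (real \<Rightarrow> complex) \<Rightarrow> real \<Rightarrow> complex" where
  "convolution f g x = (LINT y|lborel. f (x - y) * g y)"

text \<open>The distributional derivative of an element of \<open>H_space 1\<close>.\<close>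

definition deriv_L2 :: "(real \<Rightarrow> complex) \<Rightarrow> real \<Rightarrow> complex" where
  "deriv_L2 h = inv_fourier (\<lambda>\<xi>. \<i> * of_real \<xi> * fourier h \<xi>)"

definition lax :: "(real \<Rightarrow> complex) \<Rightarrow> (real \<Rightarrow> complex) \<Rightarrow> real \<Rightarrow> complex" where
  "lax u h x = - \<i> * deriv_L2 h x - u x * szego (\<lambda>y. cnj (u y) * h y) x"

text \<open>Eigenvalues of the operator \<open>lax u\<close> with domain \<open>H_plus 1\<close>.\<close>

definition sigma_pp :: "(real \<Rightarrow> complex) \<Rightarrow> complex set" where
  "sigma_pp u = {\<mu>. \<exists>h \<in> H_plus 1. \<not> (AE x in lborel. h x = 0) \<and>
                      (AE x in lborel. lax u h x = \<mu> * h x)}"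

definition is_solution ::
  "(real \<Rightarrow> complex) \<Rightarrow> real \<Rightarrow> complex \<Rightarrow> (real \<Rightarrow> complex) \<Rightarrow> bool" where
  "is_solution u s k \<phi> \<longleftrightarrow> \<phi> \<in> Linf_weighted (- s) \<and>
     (AE x in lborel. \<phi> x =
        1 + convolution (G k) (\<lambda>y. u y * szego (\<lambda>z. cnj (u z) * \<phi> z) y) x)"

end

theory Submission
  imports Defs "HOL-Probability.Levy"
begin

text \<open>
  Since \<open>u\<close> has spectrum in \<open>[0, \<infinity>)\<close>, its conjugate is annihilated by the projector, so \<open>1\<close> is a
  solution. If \<open>\<phi>\<close> is any solution, then \<open>w = \<phi> - 1\<close> equals \<open>G k * (u \<Pi>(cnj u w))\<close>. On the
  Fourier side this reads \<open>(\<xi> - k) w^ = (u \<Pi>(cnj u w))^\<close>, because a product of two functions with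
  spectrum in \<open>[0, \<infinity>)\<close> has spectrum in \<open>[0, \<infinity>)\<close>; hence \<open>w\<close> lies in the domain of the Lax operator
  and is an eigenfunction for \<open>k\<close> unless it vanishes. The Lax operator is symmetric, so a non-real
  \<open>k\<close> is no eigenvalue.

  The Fourier transform on \<open>L2\<close> rests on two facts. Gaussian summation of the inversion integral
  averages \<open>f\<close> against a normal density, so Schur's test bounds the transform. Levy's inversion
  formula for a Dirac measure is Fourier inversion for indicators of intervals, which extends to
  \<open>L2\<close> by the duality \<open>\<integral> f^ g = \<integral> f g^\<close>.
\<close>

section \<open>Square integrable functions\<close>

definition sqnorm :: "'a measure \<Rightarrow> ('a \<Rightarrow> 'b::real_normed_vector) \<Rightarrow> ennreal" where
  "sqnorm M f = (\<integral>\<^sup>+x. ennreal ((norm (f x))\<^sup>2) \<partial>M)"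

lemma sqnorm_le_AE:
  assumes [measurable]: "g \<in> borel_measurable M"
    and "AE x in M. norm (f x) \<le> B * norm (g x)"
  shows "sqnorm M f \<le> ennreal (B\<^sup>2) * sqnorm M g"
proof -
  have "AE x in M. (norm (f x))\<^sup>2 \<le> B\<^sup>2 * (norm (g x))\<^sup>2"
    using assms(2) by eventually_elim (metis norm_ge_zero power_mono power_mult_distrib)
  then have "sqnorm M f \<le> (\<integral>\<^sup>+x. ennreal (B\<^sup>2) * ennreal ((norm (g x))\<^sup>2) \<partial>M)"
    unfolding sqnorm_def
    by (intro nn_integral_mono_AE)
      (auto elim!: eventually_mono simp flip: ennreal_mult intro: ennreal_leI)
  then show ?thesis
    by (simp add: sqnorm_def nn_integral_cmult)
qed

lemma sqnorm_mono_AE: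
  assumes "g \<in> borel_measurable M" "AE x in M. norm (f x) \<le> norm (g x)"
  shows "sqnorm M f \<le> sqnorm M g"
  using sqnorm_le_AE[OF assms(1), of f 1] assms(2) by simp

lemma sqnorm_add_le:
  fixes f g :: "'a \<Rightarrow> 'b::{real_normed_vector, second_countable_topology}"
  assumes [measurable]: "f \<in> borel_measurable M" "g \<in> borel_measurable M"
  shows "sqnorm M (\<lambda>x. f x + g x) \<le> 2 * sqnorm M f + 2 * sqnorm M g"
proof -
  have "(norm (f x + g x))\<^sup>2 \<le> 2 * (norm (f x))\<^sup>2 + 2 * (norm (g x))\<^sup>2" for x
    using power_mono[OF norm_triangle_ineq[of "f x" "g x"], of 2]
      sum_squares_bound[of "norm (f x)" "norm (g x)"]
    by (simp add: power2_sum)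
  then have "sqnorm M (\<lambda>x. f x + g x) \<le>
      (\<integral>\<^sup>+x. ennreal (2 * (norm (f x))\<^sup>2 + 2 * (norm (g x))\<^sup>2) \<partial>M)"
    unfolding sqnorm_def by (intro nn_integral_mono ennreal_leI)
  also have "\<dots> = 2 * sqnorm M f + 2 * sqnorm M g"
    by (simp add: ennreal_plus ennreal_mult nn_integral_add nn_integral_cmult sqnorm_def)
  finally show ?thesis .
qed

lemma sqnorm_eq_0_iff:
  assumes [measurable]: "f \<in> borel_measurable M"
  shows "sqnorm M f = 0 \<longleftrightarrow> (AE x in M. f x = 0)"
  unfolding sqnorm_def by (subst nn_integral_0_iff_AE) auto

lemma sqnorm_lborel_affine:
  fixes c :: real
  assumes "f \<in> borel_measurable borel" "c \<noteq> 0"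
  shows "sqnorm lborel f = ennreal \<bar>c\<bar> * sqnorm lborel (\<lambda>x. f (t + c * x))"
  unfolding sqnorm_def
  by (rule nn_integral_real_affine[of "\<lambda>x. ennreal ((norm (f x))\<^sup>2)" c t]) (use assms in auto)

lemma sqnorm_le_liminf:
  assumes [measurable]: "\<And>n. f n \<in> borel_measurable M"
    and lim: "AE x in M. (\<lambda>n. f n x) \<longlonglongrightarrow> g x"
  shows "sqnorm M g \<le> liminf (\<lambda>n. sqnorm M (f n))"
proof -
  have "AE x in M. ennreal ((norm (g x))\<^sup>2) = liminf (\<lambda>n. ennreal ((norm (f n x))\<^sup>2))"
    using lim
  proof eventually_elim
    case (elim x)
    then have "(\<lambda>n. ennreal ((norm (f n x))\<^sup>2)) \<longlonglongrightarrow> ennreal ((norm (g x))\<^sup>2)"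
      by (intro tendsto_intros)
    then show ?case
      by (intro lim_imp_Liminf[symmetric]) auto
  qed
  then have "sqnorm M g = (\<integral>\<^sup>+x. liminf (\<lambda>n. ennreal ((norm (f n x))\<^sup>2)) \<partial>M)"
    unfolding sqnorm_def by (rule nn_integral_cong_AE)
  also have "\<dots> \<le> liminf (\<lambda>n. sqnorm M (f n))"
    unfolding sqnorm_def by (intro nn_integral_liminf) measurable
  finally show ?thesis .
qed

lemma sqnorm_le_if_AE_tendsto:
  assumes "\<And>n. f n \<in> borel_measurable M" "AE x in M. (\<lambda>n. f n x) \<longlonglongrightarrow> g x"
    and "\<forall>\<^sub>F n in sequentially. sqnorm M (f n) \<le> C"
  shows "sqnorm M g \<le> C"
proof -
  have "sqnorm M g \<le> liminf (\<lambda>n. sqnorm M (f n))"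
    by (rule sqnorm_le_liminf[OF assms(1,2)])
  also have "\<dots> \<le> limsup (\<lambda>n. sqnorm M (f n))"
    by (rule Liminf_le_Limsup) simp
  also have "\<dots> \<le> C"
    by (rule Limsup_bounded[OF assms(3)])
  finally show ?thesis .
qed

lemma nn_integral_Cauchy_Schwarz:
  assumes [measurable]: "f \<in> borel_measurable M" "g \<in> borel_measurable M"
  shows "(\<integral>\<^sup>+x. ennreal (norm (f x) * norm (g x)) \<partial>M)\<^sup>2 \<le> sqnorm M f * sqnorm M g"
    (is "?I\<^sup>2 \<le> _")
proof -
  consider "sqnorm M f = 0 \<or> sqnorm M g = 0"
    | "sqnorm M f \<noteq> 0" "sqnorm M g \<noteq> 0" "sqnorm M f = top \<or> sqnorm M g = top"
    | A B where "0 < A" "sqnorm M f = ennreal A" "0 < B" "sqnorm M g = ennreal B"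
    by (metis ennreal_cases ennreal_0 order_le_less)
  then show ?thesis
  proof cases
    case 1
    then have "AE x in M. norm (f x) * norm (g x) = 0"
      by (auto simp: sqnorm_eq_0_iff elim: eventually_mono)
    then have "?I = (\<integral>\<^sup>+x. 0 \<partial>M)"
      by (intro nn_integral_cong_AE) (auto elim: eventually_mono)
    then show ?thesis by simp
  next
    case 2
    then show ?thesis by (auto simp: ennreal_mult_top ennreal_top_mult)
  next
    case 3
    define t where "t = sqrt (B / A)"
    have t: "t > 0" "t * A = sqrt (A * B)" "B / t = sqrt (A * B)"
      using 3 by (simp_all add: t_def real_sqrt_divide real_sqrt_mult field_simps)
    have weighted: "norm (f x) * norm (g x) \<le>
        t / 2 * (norm (f x))\<^sup>2 + 1 / (2 * t) * (norm (g x))\<^sup>2" for x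
      using sum_squares_bound[of "sqrt t * norm (f x)" "norm (g x) / sqrt t"] t(1)
      by (simp add: power_mult_distrib power_divide field_simps)
    have "?I \<le> (\<integral>\<^sup>+x. ennreal (t / 2) * ennreal ((norm (f x))\<^sup>2) +
        ennreal (1 / (2 * t)) * ennreal ((norm (g x))\<^sup>2) \<partial>M)"
      using weighted t(1)
      by (intro nn_integral_mono) (simp flip: ennreal_mult ennreal_plus add: ennreal_leI)
    also have "\<dots> = ennreal (t / 2) * ennreal A + ennreal (1 / (2 * t)) * ennreal B"
      using 3 by (simp add: nn_integral_add nn_integral_cmult flip: sqnorm_def)
    also have "\<dots> = ennreal (sqrt (A * B))"
      using 3 t by (simp flip: ennreal_mult ennreal_plus)
    finally have "?I\<^sup>2 \<le> (ennreal (sqrt (A * B)))\<^sup>2"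
      by (intro power_mono) auto
    then show ?thesis
      using 3 by (simp add: ennreal_power ennreal_mult)
  qed
qed

lemma ennreal_norm_integral_le:
  fixes f :: "'a \<Rightarrow> 'b::{banach, second_countable_topology}"
  shows "ennreal (norm (LINT x|M. f x)) \<le> (\<integral>\<^sup>+x. ennreal (norm (f x)) \<partial>M)"
  by (cases "integrable M f") (simp_all add: integral_norm_bound_ennreal not_integrable_integral_eq)

lemma integral_norm_mult_squared_le:
  fixes f g :: "'a \<Rightarrow> 'b::{real_normed_algebra, banach, second_countable_topology}"
  assumes [measurable]: "f \<in> borel_measurable M" "g \<in> borel_measurable M"
  shows "ennreal ((LINT x|M. norm (f x * g x))\<^sup>2) \<le> sqnorm M f * sqnorm M g"
proof -
  have "ennreal (LINT x|M. norm (f x * g x)) \<le> (\<integral>\<^sup>+x. ennreal (norm (f x * g x)) \<partial>M)"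
    using ennreal_norm_integral_le[of M "\<lambda>x. norm (f x * g x)"] by simp
  also have "\<dots> \<le> (\<integral>\<^sup>+x. ennreal (norm (f x) * norm (g x)) \<partial>M)"
    by (intro nn_integral_mono ennreal_leI norm_mult_ineq)
  finally have "(ennreal (LINT x|M. norm (f x * g x)))\<^sup>2 \<le>
      (\<integral>\<^sup>+x. ennreal (norm (f x) * norm (g x)) \<partial>M)\<^sup>2"
    by (intro power_mono) auto
  also have "\<dots> \<le> sqnorm M f * sqnorm M g"
    by (rule nn_integral_Cauchy_Schwarz) measurable
  finally show ?thesis
    by (simp add: ennreal_power)
qed

lemma tendsto_0_mono_ennreal:
  fixes f g :: "'i \<Rightarrow> ennreal"
  assumes "(g \<longlongrightarrow> 0) F" "\<And>i. f i \<le> g i"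
  shows "(f \<longlongrightarrow> 0) F"
  by (rule tendsto_sandwich[OF _ _ tendsto_const assms(1)]) (simp_all add: assms(2))

definition tendsto_L2 ::
  "'a measure \<Rightarrow> ('i \<Rightarrow> 'a \<Rightarrow> 'b::real_normed_vector) \<Rightarrow> ('a \<Rightarrow> 'b) \<Rightarrow> 'i filter \<Rightarrow> bool" where
  "tendsto_L2 M f g F \<longleftrightarrow> ((\<lambda>i. sqnorm M (\<lambda>x. g x - f i x)) \<longlongrightarrow> 0) F"

lemma tendsto_L2_dominated:
  fixes C :: real
  assumes "tendsto_L2 M f g F"
    and "\<And>i. sqnorm N (\<lambda>x. g' x - f' i x) \<le> ennreal C * sqnorm M (\<lambda>x. g x - f i x)"
  shows "tendsto_L2 N f' g' F"
  unfolding tendsto_L2_def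
proof (rule tendsto_0_mono_ennreal[OF _ assms(2)])
  show "((\<lambda>i. ennreal C * sqnorm M (\<lambda>x. g x - f i x)) \<longlongrightarrow> 0) F"
    using ennreal_tendsto_cmult[of "ennreal C", OF _ assms(1)[unfolded tendsto_L2_def]] by simp
qed

lemma tendsto_L2_add:
  fixes f :: "'i \<Rightarrow> 'a \<Rightarrow> 'b::{real_normed_vector, second_countable_topology}"
  assumes [measurable]: "\<And>i. f i \<in> borel_measurable M" "g \<in> borel_measurable M"
      "\<And>i. f' i \<in> borel_measurable M" "g' \<in> borel_measurable M"
    and lim: "tendsto_L2 M f g F" "tendsto_L2 M f' g' F"
  shows "tendsto_L2 M (\<lambda>i x. f i x + f' i x) (\<lambda>x. g x + g' x) F"
  unfolding tendsto_L2_def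
proof (rule tendsto_0_mono_ennreal)
  have "((\<lambda>i. 2 * sqnorm M (\<lambda>x. g x - f i x) + 2 * sqnorm M (\<lambda>x. g' x - f' i x)) \<longlongrightarrow> 2 * 0 + 2 * 0) F"
    using lim unfolding tendsto_L2_def by (intro tendsto_add ennreal_tendsto_cmult) auto
  then show "((\<lambda>i. 2 * sqnorm M (\<lambda>x. g x - f i x) + 2 * sqnorm M (\<lambda>x. g' x - f' i x)) \<longlongrightarrow> 0) F"
    by simp
  show "sqnorm M (\<lambda>x. (g x + g' x) - (f i x + f' i x)) \<le>
      2 * sqnorm M (\<lambda>x. g x - f i x) + 2 * sqnorm M (\<lambda>x. g' x - f' i x)" for i
    using sqnorm_add_le[of "\<lambda>x. g x - f i x" M "\<lambda>x. g' x - f' i x"] by (simp add: algebra_simps)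
qed

lemma tendsto_L2_unique:
  fixes f :: "'i \<Rightarrow> 'a \<Rightarrow> 'b::{real_normed_vector, second_countable_topology}"
  assumes "F \<noteq> bot"
    and [measurable]: "\<And>i. f i \<in> borel_measurable M" "g \<in> borel_measurable M"
      "h \<in> borel_measurable M"
    and lim: "tendsto_L2 M f g F" "tendsto_L2 M f h F"
  shows "AE x in M. g x = h x"
proof -
  have "tendsto_L2 M (\<lambda>i x. - f i x) (\<lambda>x. - h x) F"
    using lim(2) by (rule tendsto_L2_dominated[where C = 1])
      (simp add: sqnorm_def norm_minus_commute)
  with lim(1) have "tendsto_L2 M (\<lambda>i x. f i x + - f i x) (\<lambda>x. g x + - h x) F"
    by (rule tendsto_L2_add[rotated 4]) measurable
  then have "sqnorm M (\<lambda>x. g x - h x) = 0"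
    by (simp add: tendsto_L2_def tendsto_const_iff[OF assms(1)])
  then show ?thesis
    by (simp add: sqnorm_eq_0_iff)
qed

lemma tendsto_L2_AE_unique:
  fixes f :: "nat \<Rightarrow> 'a \<Rightarrow> 'b::{real_normed_vector, second_countable_topology}"
  assumes [measurable]: "\<And>n. f n \<in> borel_measurable M" "g \<in> borel_measurable M"
      "h \<in> borel_measurable M"
    and L2: "tendsto_L2 M f g sequentially" and AE: "AE x in M. (\<lambda>n. f n x) \<longlonglongrightarrow> h x"
  shows "AE x in M. g x = h x"
proof -
  have "AE x in M. (\<lambda>n. g x - f n x) \<longlonglongrightarrow> g x - h x"
    using AE by eventually_elim (intro tendsto_intros)
  then have "sqnorm M (\<lambda>x. g x - h x) \<le> liminf (\<lambda>n. sqnorm M (\<lambda>x. g x - f n x))"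
    by (intro sqnorm_le_liminf) measurable
  also have "\<dots> = 0"
    using L2 unfolding tendsto_L2_def by (intro lim_imp_Liminf) simp
  finally show ?thesis
    by (simp add: sqnorm_eq_0_iff)
qed

lemma tendsto_L2_integral_mult:
  fixes f :: "'i \<Rightarrow> 'a \<Rightarrow> 'b::{real_normed_algebra, banach, second_countable_topology}"
  assumes [measurable]: "\<And>i. f i \<in> borel_measurable M" "g \<in> borel_measurable M"
      "h \<in> borel_measurable M"
    and int: "\<And>i. integrable M (\<lambda>x. f i x * h x)" "integrable M (\<lambda>x. g x * h x)"
    and h: "sqnorm M h < \<infinity>" and lim: "tendsto_L2 M f g F"
  shows "((\<lambda>i. LINT x|M. f i x * h x) \<longlongrightarrow> (LINT x|M. g x * h x)) F"
proof -
  let ?d = "\<lambda>i. (LINT x|M. g x * h x) - (LINT x|M. f i x * h x)"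
  have "((\<lambda>i. sqnorm M h * sqnorm M (\<lambda>x. g x - f i x)) \<longlongrightarrow> 0) F"
    using ennreal_tendsto_cmult[of "sqnorm M h", OF _ lim[unfolded tendsto_L2_def]] h by simp
  then have "((\<lambda>i. ennreal ((norm (?d i))\<^sup>2)) \<longlongrightarrow> 0) F"
  proof (rule tendsto_0_mono_ennreal)
    fix i
    have "?d i = (LINT x|M. (g x - f i x) * h x)"
      using int by (simp add: left_diff_distrib)
    then have "norm (?d i) \<le> (LINT x|M. norm ((g x - f i x) * h x))"
      by (metis integral_norm_bound)
    then have "ennreal ((norm (?d i))\<^sup>2) \<le> ennreal ((LINT x|M. norm ((g x - f i x) * h x))\<^sup>2)"
      by (intro ennreal_leI power_mono) auto
    also have "\<dots> \<le> sqnorm M (\<lambda>x. g x - f i x) * sqnorm M h"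
      by (rule integral_norm_mult_squared_le) measurable
    finally show "ennreal ((norm (?d i))\<^sup>2) \<le> sqnorm M h * sqnorm M (\<lambda>x. g x - f i x)"
      by (simp add: mult.commute)
  qed
  then have "((\<lambda>i. (norm (?d i))\<^sup>2) \<longlongrightarrow> 0) F"
    by (subst (asm) ennreal_0[symmetric], subst (asm) tendsto_ennreal_iff) auto
  from tendsto_real_sqrt[OF this] have "((\<lambda>i. norm (?d i)) \<longlongrightarrow> 0) F"
    by simp
  then have "(?d \<longlongrightarrow> 0) F"
    by (rule tendsto_norm_zero_cancel)
  then show ?thesis
    using tendsto_diff[OF tendsto_const[of "LINT x|M. g x * h x"], of ?d 0] by simp
qed

lemma L2_iff: "f \<in> L2 \<longleftrightarrow> f \<in> borel_measurable borel \<and> sqnorm lborel f < \<infinity>"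
  by (auto simp: L2_def sqnorm_def integrable_iff_bounded)

lemma L2_measurable [measurable_dest]: "f \<in> L2 \<Longrightarrow> f \<in> borel_measurable borel"
  by (simp add: L2_iff)

lemma L2_dominated:
  assumes "f \<in> L2" "g \<in> borel_measurable borel" "AE x in lborel. cmod (g x) \<le> B * cmod (f x)"
  shows "g \<in> L2"
proof -
  have "sqnorm lborel g \<le> ennreal (B\<^sup>2) * sqnorm lborel f"
    using assms by (intro sqnorm_le_AE) auto
  also have "\<dots> < \<infinity>"
    using assms(1) by (simp add: L2_iff ennreal_mult_less_top)
  finally show ?thesis
    using assms(2) by (simp add: L2_iff)
qed

lemma L2_mult_bounded:
  assumes "f \<in> L2" "h \<in> borel_measurable borel" "AE x in lborel. cmod (h x) \<le> B"
  shows "(\<lambda>x. h x * f x) \<in> L2"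
proof (rule L2_dominated[OF assms(1)])
  show "(\<lambda>x. h x * f x) \<in> borel_measurable borel"
    using assms by measurable
  show "AE x in lborel. cmod (h x * f x) \<le> B * cmod (f x)"
    using assms(3) by eventually_elim (simp add: norm_mult mult_right_mono)
qed

lemma L2_cmult: "f \<in> L2 \<Longrightarrow> (\<lambda>x. c * f x) \<in> L2"
  by (rule L2_mult_bounded[where B = "cmod c"]) auto

lemma L2_cong_AE:
  assumes "f \<in> L2" "g \<in> borel_measurable borel" "AE x in lborel. f x = g x"
  shows "g \<in> L2"
  using assms(3) by (intro L2_dominated[OF assms(1,2), of 1]) (auto elim: eventually_mono)

lemma borel_measurable_cnj [measurable]: "cnj \<in> borel_measurable borel"
  by (intro borel_measurable_continuous_onI continuous_intros)

lemma L2_cnj: "f \<in> L2 \<Longrightarrow> (\<lambda>x. cnj (f x)) \<in> L2"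
  by (rule L2_dominated[where f = f and B = 1]) (auto dest: L2_measurable)

lemma L2_add: "f \<in> L2 \<Longrightarrow> g \<in> L2 \<Longrightarrow> (\<lambda>x. f x + g x) \<in> L2"
  using sqnorm_add_le[of f lborel g]
  by (auto simp: L2_iff ennreal_mult_less_top intro: le_less_trans)

lemma L2_diff: "f \<in> L2 \<Longrightarrow> g \<in> L2 \<Longrightarrow> (\<lambda>x. f x - g x) \<in> L2"
  using L2_add[of f "\<lambda>x. -1 * g x"] L2_cmult[of g "-1"] by simp

lemma L2_affine:
  assumes "f \<in> L2" "c \<noteq> 0"
  shows "(\<lambda>x. f (t + c * x)) \<in> L2"
  using assms L2_measurable[OF assms(1)] lborel_integrable_real_affine[of "\<lambda>x. (cmod (f x))\<^sup>2" c t]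
  by (simp add: L2_def)

lemma L2_reflect: "f \<in> L2 \<Longrightarrow> (\<lambda>x. f (- x)) \<in> L2"
  using L2_affine[of f "-1" 0] by simp

lemma L2_indicator:
  assumes "A \<in> sets lborel" "emeasure lborel A < \<infinity>"
  shows "indicator A \<in> L2"
proof -
  have "sqnorm lborel (indicator A :: real \<Rightarrow> complex) = (\<integral>\<^sup>+x. indicator A x \<partial>lborel)"
    unfolding sqnorm_def by (intro nn_integral_cong) (auto simp: indicator_def)
  then show ?thesis
    using assms by (simp add: L2_iff)
qed

lemma of_real_add_ii_neq_0 [simp]: "complex_of_real x + \<i> \<noteq> 0"
  by (simp add: complex_eq_iff)

lemma L2_inverse_add_ii: "(\<lambda>x. inverse (of_real x + \<i>)) \<in> L2"
proof -
  have "(\<lambda>x. (cmod (inverse (complex_of_real x + \<i>)))\<^sup>2) = (\<lambda>x. inverse (1 + x\<^sup>2))"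
    unfolding norm_inverse power_inverse cmod_power2 by (simp add: add.commute)
  moreover have "integrable lborel (\<lambda>x::real. inverse (1 + x\<^sup>2))"
    using integrable_inverse_1_plus_square by (simp add: set_integrable_def)
  ultimately have "integrable lborel (\<lambda>x. (cmod (inverse (complex_of_real x + \<i>)))\<^sup>2)"
    by (simp only:)
  moreover have "(\<lambda>x. inverse (complex_of_real x + \<i>)) \<in> borel_measurable lborel"
    by measurable
  ultimately show ?thesis
    unfolding L2_def by blast
qed

lemma L2_mult_integrable:
  assumes f: "f \<in> L2" and g: "g \<in> L2"
  shows "integrable lborel (\<lambda>x. f x * g x)"
proof (rule integrableI_bounded)
  let ?I = "\<integral>\<^sup>+x. ennreal (cmod (f x) * cmod (g x)) \<partial>lborel"
  have "?I\<^sup>2 \<le> sqnorm lborel f * sqnorm lborel g"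
    by (rule nn_integral_Cauchy_Schwarz) (use f g in measurable)
  also have "\<dots> < \<infinity>"
    using f g by (simp add: L2_iff ennreal_mult_less_top)
  finally have "?I < \<infinity>"
    by (auto simp: power2_eq_square ennreal_mult_less_top)
  then show "(\<integral>\<^sup>+x. ennreal (cmod (f x * g x)) \<partial>lborel) < \<infinity>"
    by (simp add: norm_mult)
qed (use f g in measurable)

text \<open>After multiplication by a nowhere vanishing element of \<open>L2\<close> the sequence is Cauchy in \<open>L\<^sup>1\<close>.\<close>

lemma L2_Cauchy_AE_convergent_subseq:
  fixes f :: "nat \<Rightarrow> real \<Rightarrow> complex"
  assumes f: "\<And>n. f n \<in> L2" and \<epsilon>: "\<epsilon> \<longlonglongrightarrow> 0"
    and diff: "\<And>i j. i \<le> j \<Longrightarrow> sqnorm lborel (\<lambda>x. f j x - f i x) \<le> \<epsilon> i"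
  obtains r where "strict_mono r" "AE x in lborel. convergent (\<lambda>n. f (r n) x)"
proof -
  define w :: "real \<Rightarrow> complex" where "w x = inverse (of_real x + \<i>)" for x
  have w: "w \<in> L2"
    using L2_inverse_add_ii by (simp add: w_def[abs_def])
  have w_nz: "w x \<noteq> 0" for x
    by (simp add: w_def)
  let ?I = "\<lambda>i j. LINT x|lborel. norm (f i x * w x - f j x * w x)"
  have "\<exists>N. \<forall>i\<ge>N. \<forall>j\<ge>N. ?I i j < e" if e: "e > 0" for e
  proof -
    have "(\<lambda>n. sqnorm lborel w * \<epsilon> n) \<longlonglongrightarrow> 0"
      using ennreal_tendsto_cmult[OF _ \<epsilon>, of "sqnorm lborel w"] w by (simp add: L2_iff)
    from order_tendstoD(2)[OF this, of "ennreal (e\<^sup>2)"] e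
    obtain N where N: "sqnorm lborel w * \<epsilon> n < ennreal (e\<^sup>2)" if "n \<ge> N" for n
      by (auto simp: eventually_sequentially)
    have ordered: "?I j i < e" if "N \<le> i" "i \<le> j" for i j
    proof -
      have "ennreal ((?I j i)\<^sup>2) \<le> sqnorm lborel (\<lambda>x. f j x - f i x) * sqnorm lborel w"
        using integral_norm_mult_squared_le[of "\<lambda>x. f j x - f i x" lborel w]
          L2_measurable[OF L2_diff[OF f f], of j i] L2_measurable[OF w]
        by (simp add: left_diff_distrib)
      also have "\<dots> \<le> sqnorm lborel w * \<epsilon> i"
        using diff[OF that(2)] by (subst mult.commute) (rule mult_left_mono, simp_all)
      also have "\<dots> < ennreal (e\<^sup>2)"
        by (rule N[OF that(1)])
      finally show ?thesis
        using e by (auto simp: ennreal_less_iff intro: power2_less_imp_less)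
    qed
    have "?I i j < e" if "N \<le> i" "N \<le> j" for i j
      using ordered[of i j] ordered[of j i] that
      by (cases "i \<le> j") (simp_all add: norm_minus_commute)
    then show ?thesis by (intro exI[of _ N]) simp
  qed
  then obtain r where r: "strict_mono r" "AE x in lborel. Cauchy (\<lambda>n. f (r n) x * w x)"
    by (rule cauchy_L1_AE_cauchy_subseq
          [of lborel "\<lambda>n x. f n x * w x", OF L2_mult_integrable[OF f w]])
  from r(2) have "AE x in lborel. convergent (\<lambda>n. f (r n) x)"
    by eventually_elim (simp add: Cauchy_convergent_iff convergent_mult_const_right_iff w_nz)
  with r(1) show thesis by (rule that)
qed

lemma L2_complete:
  fixes F :: "real \<Rightarrow> real \<Rightarrow> complex"
  assumes F: "\<And>R. F R \<in> L2" and \<epsilon>: "(\<epsilon> \<longlongrightarrow> 0) at_top"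
    and diff: "\<And>R S. R \<le> S \<Longrightarrow> sqnorm lborel (\<lambda>x. F S x - F R x) \<le> \<epsilon> R"
  shows "\<exists>g\<in>L2. tendsto_L2 lborel F g at_top"
proof -
  have [measurable]: "F R \<in> borel_measurable borel" for R
    using F by measurable
  obtain r where r: "strict_mono r" "AE x in lborel. convergent (\<lambda>n. F (real (r n)) x)"
  proof (rule L2_Cauchy_AE_convergent_subseq[of "\<lambda>n. F (real n)"])
    show "(\<lambda>n. \<epsilon> (real n)) \<longlonglongrightarrow> 0"
      by (rule filterlim_compose[OF \<epsilon> filterlim_real_sequentially])
  qed (use F diff in simp_all)
  define g where "g x = lim (\<lambda>n. F (real (r n)) x)" for x
  have lim: "AE x in lborel. (\<lambda>n. F (real (r n)) x) \<longlonglongrightarrow> g x"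
    using r(2) by eventually_elim (simp add: g_def convergent_LIMSEQ_iff)
  have bound: "sqnorm lborel (\<lambda>x. g x - F R x) \<le> \<epsilon> R" for R
  proof (rule sqnorm_le_if_AE_tendsto)
    show "AE x in lborel. (\<lambda>n. F (real (r n)) x - F R x) \<longlonglongrightarrow> g x - F R x"
      using lim by eventually_elim (intro tendsto_intros)
    have "\<forall>\<^sub>F n in sequentially. R \<le> real (r n)"
      using filterlim_compose[OF filterlim_real_sequentially filterlim_subseq[OF r(1)]]
      by (simp add: filterlim_at_top)
    then show "\<forall>\<^sub>F n in sequentially. sqnorm lborel (\<lambda>x. F (real (r n)) x - F R x) \<le> \<epsilon> R"
      by eventually_elim (rule diff)
  qed measurable
  have "tendsto_L2 lborel F g at_top"
    unfolding tendsto_L2_def using \<epsilon> bound by (rule tendsto_0_mono_ennreal)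
  moreover have "g \<in> L2"
  proof -
    from order_tendstoD(2)[OF \<epsilon>, of 1] obtain R where "\<epsilon> R < 1"
      by (auto simp: eventually_at_top_linorder)
    with bound[of R] have "sqnorm lborel (\<lambda>x. g x - F R x) < \<infinity>"
      by (auto intro: le_less_trans less_trans)
    moreover have "g \<in> borel_measurable borel"
      unfolding g_def by measurable
    ultimately have "(\<lambda>x. g x - F R x) \<in> L2"
      by (simp add: L2_iff)
    from L2_add[OF this F[of R]] show ?thesis by simp
  qed
  ultimately show ?thesis by blast
qed

section \<open>The Fourier integral\<close>

definition fourier_integral :: "(real \<Rightarrow> complex) \<Rightarrow> real \<Rightarrow> complex" where
  "fourier_integral f \<xi> = (LINT x|lborel. f x * cis (- (x * \<xi>)))"

lemma borel_measurable_cis [measurable]: "cis \<in> borel_measurable borel"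
  by (intro borel_measurable_continuous_onI continuous_intros)

lemma borel_measurable_fourier_integral [measurable]:
  assumes [measurable]: "f \<in> borel_measurable borel"
  shows "fourier_integral f \<in> borel_measurable borel"
  unfolding fourier_integral_def by measurable

lemma integrable_mult_bounded:
  fixes f g :: "'a \<Rightarrow> 'b::{real_normed_algebra, banach, second_countable_topology}"
  assumes f: "integrable M f" and g: "g \<in> borel_measurable M" "\<And>x. norm (g x) \<le> B"
  shows "integrable M (\<lambda>x. f x * g x)"
proof (rule Bochner_Integration.integrable_bound)
  show "integrable M (\<lambda>x. norm (f x) * B)"
    using f by simp
  show "(\<lambda>x. f x * g x) \<in> borel_measurable M"
    using f g(1) by measurable
  have "norm (f x * g x) \<le> norm (f x) * B" for x
    using norm_mult_ineq mult_left_mono[OF g(2) norm_ge_zero] by (rule order_trans)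
  then show "AE x in M. norm (f x * g x) \<le> norm (norm (f x) * B)"
    by (intro AE_I2) (auto intro: order_trans[OF _ abs_ge_self])
qed

lemma integrable_mult_cis: "integrable lborel f \<Longrightarrow> integrable lborel (\<lambda>x. f x * cis (- (x * \<xi>)))"
  by (rule integrable_mult_bounded[where B = 1]) auto

lemma norm_fourier_integral_le: "cmod (fourier_integral f \<xi>) \<le> (LINT x|lborel. cmod (f x))"
  unfolding fourier_integral_def
  using integral_norm_bound[of lborel "\<lambda>x. f x * cis (- (x * \<xi>))"] by (simp add: norm_mult)

lemma fourier_integral_diff:
  assumes "integrable lborel f" "integrable lborel g"
  shows "fourier_integral (\<lambda>x. f x - g x) = (\<lambda>\<xi>. fourier_integral f \<xi> - fourier_integral g \<xi>)"
  using integrable_mult_cis[OF assms(1)] integrable_mult_cis[OF assms(2)]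
  by (simp add: fourier_integral_def fun_eq_iff left_diff_distrib)

lemma fourier_integral_cnj: "fourier_integral (\<lambda>x. cnj (f x)) \<xi> = cnj (fourier_integral f (- \<xi>))"
  by (simp add: fourier_integral_def cis_cnj flip: Bochner_Integration.integral_cnj)

lemma fourier_integral_modulate:
  "fourier_integral (\<lambda>x. cis (- (x * a)) * f x) \<xi> = fourier_integral f (a + \<xi>)"
  unfolding fourier_integral_def
  by (intro Bochner_Integration.integral_cong) (simp_all add: algebra_simps cis_mult)

lemma fourier_integral_multiplication:
  assumes f: "integrable lborel f" and g: "integrable lborel g"
  shows "(LINT \<xi>|lborel. fourier_integral f \<xi> * g \<xi>) = (LINT x|lborel. f x * fourier_integral g x)"
proof -
  let ?k = "\<lambda>x \<xi>. f x * cis (- (x * \<xi>)) * g \<xi>"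
  have [measurable]: "f \<in> borel_measurable borel" "g \<in> borel_measurable borel"
    using f g by auto
  have "integrable (lborel \<Otimes>\<^sub>M lborel) (case_prod ?k)"
  proof (rule lborel_pair.Fubini_integrable)
    show "AE x in lborel. integrable lborel (\<lambda>\<xi>. case (x, \<xi>) of (x, \<xi>) \<Rightarrow> ?k x \<xi>)"
    proof (rule AE_I2)
      fix x
      show "integrable lborel (\<lambda>\<xi>. case (x, \<xi>) of (x, \<xi>) \<Rightarrow> ?k x \<xi>)"
        using integrable_mult_right[OF integrable_mult_cis[OF g, of x], of "f x"]
        by (simp add: mult_ac)
    qed
    show "integrable lborel (\<lambda>x. \<integral>\<xi>. norm (case (x, \<xi>) of (x, \<xi>) \<Rightarrow> ?k x \<xi>) \<partial>lborel)"
      using f by (simp add: norm_mult)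
  qed measurable
  then have "(LINT \<xi>|lborel. LINT x|lborel. ?k x \<xi>) = (LINT x|lborel. LINT \<xi>|lborel. ?k x \<xi>)"
    by (rule lborel_pair.Fubini_integral)
  then show ?thesis
    by (simp add: fourier_integral_def mult_ac flip: integral_mult_right_zero)
qed

section \<open>The \<open>L2\<close> bound for the Fourier integral\<close>

definition gauss :: "real \<Rightarrow> real \<Rightarrow> real" where
  "gauss \<epsilon> \<xi> = exp (- (\<epsilon> * \<xi>)\<^sup>2 / 2)"

lemma gauss_nonneg [simp]: "0 \<le> gauss \<epsilon> \<xi>"
  by (simp add: gauss_def)

lemma borel_measurable_gauss [measurable]: "gauss \<epsilon> \<in> borel_measurable borel"
  unfolding gauss_def by measurable

lemma gauss_eq_std_normal_density: "gauss \<epsilon> \<xi> = sqrt (2 * pi) * std_normal_density (0 + \<epsilon> * \<xi>)"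
  by (simp add: gauss_def std_normal_density_def)

lemma integrable_gauss: "\<epsilon> \<noteq> 0 \<Longrightarrow> integrable lborel (gauss \<epsilon>)"
  unfolding gauss_eq_std_normal_density[abs_def]
  by (intro integrable_mult_right lborel_integrable_real_affine) auto

lemma gauss_tendsto_1: "(\<lambda>n. gauss (inverse (real (Suc n))) \<xi>) \<longlonglongrightarrow> 1"
proof -
  have "(\<lambda>n. exp (- (inverse (real (Suc n)) * \<xi>)\<^sup>2 / 2)) \<longlonglongrightarrow> exp (- (0 * \<xi>)\<^sup>2 / 2)"
    by (intro tendsto_intros LIMSEQ_inverse_real_of_nat) auto
  then show ?thesis
    by (simp add: gauss_def)
qed

lemma fourier_integral_std_normal_density:
  "fourier_integral (\<lambda>x. of_real (std_normal_density x)) \<xi> = of_real (exp (- \<xi>\<^sup>2 / 2))"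
proof -
  have "fourier_integral (\<lambda>x. of_real (std_normal_density x)) \<xi> =
      char std_normal_distribution (- \<xi>)"
    unfolding char_def fourier_integral_def
    by (subst integral_density) (auto simp: scaleR_conv_of_real cis_conv_exp mult_ac)
  then show ?thesis
    by (simp add: char_std_normal_distribution)
qed

lemma fourier_integral_gauss:
  assumes \<epsilon>: "\<epsilon> > 0"
  shows "fourier_integral (\<lambda>\<xi>. of_real (gauss \<epsilon> \<xi>)) x = of_real (2 * pi * normal_density 0 \<epsilon> x)"
proof -
  have "fourier_integral (\<lambda>\<xi>. of_real (gauss \<epsilon> \<xi>)) x =
      (LINT \<xi>|lborel. of_real (sqrt (2 * pi)) *
        (of_real (std_normal_density (0 + \<epsilon> * \<xi>)) * cis (- ((0 + \<epsilon> * \<xi>) * (x / \<epsilon>)))))"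
    unfolding fourier_integral_def gauss_eq_std_normal_density using \<epsilon> by (simp add: mult.assoc)
  also have "\<dots> = of_real (sqrt (2 * pi) / \<epsilon>) *
      fourier_integral (\<lambda>t. of_real (std_normal_density t)) (x / \<epsilon>)"
    using lborel_integral_real_affine
      [of \<epsilon> "\<lambda>t. of_real (std_normal_density t) * cis (- (t * (x / \<epsilon>)))" 0] \<epsilon>
    by (simp add: fourier_integral_def scaleR_conv_of_real)
  also have "\<dots> = of_real (sqrt (2 * pi) / \<epsilon> * exp (- (x / \<epsilon>)\<^sup>2 / 2))"
    by (simp only: fourier_integral_std_normal_density of_real_mult)
  also have "sqrt (2 * pi) / \<epsilon> * exp (- (x / \<epsilon>)\<^sup>2 / 2) = 2 * pi * normal_density 0 \<epsilon> x"
    using \<epsilon> by (simp add: normal_density_def real_sqrt_mult field_simps)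
  finally show ?thesis .
qed

lemma fourier_integral_gauss_mult_fourier_integral:
  fixes f :: "real \<Rightarrow> complex"
  assumes f: "integrable lborel f" and \<epsilon>: "\<epsilon> > 0"
  shows "fourier_integral (\<lambda>\<xi>. of_real (gauss \<epsilon> \<xi>) * fourier_integral f \<xi>) (- x) =
    2 * pi * (LINT y|lborel. f y * of_real (normal_density x \<epsilon> y))"
proof -
  let ?g = "\<lambda>\<xi>. cis (- (\<xi> * (- x))) * of_real (gauss \<epsilon> \<xi>)"
  have "integrable lborel (\<lambda>\<xi>. complex_of_real (gauss \<epsilon> \<xi>) * cis (- (\<xi> * (- x))))"
    using \<epsilon> by (intro integrable_mult_cis integrable_of_real integrable_gauss) simp
  then have g: "integrable lborel ?g"
    by (simp add: mult.commute)
  have "fourier_integral (\<lambda>\<xi>. of_real (gauss \<epsilon> \<xi>) * fourier_integral f \<xi>) (- x) =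
      (LINT \<xi>|lborel. fourier_integral f \<xi> * ?g \<xi>)"
    by (simp add: fourier_integral_def[of "\<lambda>\<xi>. _ \<xi> * _ \<xi>"] mult_ac)
  also have "\<dots> = (LINT y|lborel. f y * fourier_integral ?g y)"
    by (rule fourier_integral_multiplication[OF f g])
  also have "\<dots> = (LINT y|lborel. 2 * pi * (f y * of_real (normal_density x \<epsilon> y)))"
    unfolding fourier_integral_modulate fourier_integral_gauss[OF \<epsilon>]
    by (simp add: normal_density_def mult_ac)
  finally show ?thesis
    by (simp only: integral_mult_right_zero)
qed

lemma ennreal_sum_squares_bound: "2 * a * b \<le> a\<^sup>2 + (b::ennreal)\<^sup>2"
proof (cases "a = top \<or> b = top")
  case True
  then show ?thesis by auto
next
  case False
  then obtain x y where "a = ennreal x" "x \<ge> 0" "b = ennreal y" "y \<ge> 0"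
    by (metis ennreal_cases)
  moreover from this have "2 * a * b = ennreal (2 * x * y)"
    by (simp add: ennreal_mult)
  ultimately show ?thesis
    using sum_squares_bound[of x y] by (simp add: ennreal_power ennreal_leI flip: ennreal_plus)
qed

lemma nn_integral_kernel_le:
  assumes "sigma_finite_measure N"
    and [measurable]: "case_prod K \<in> borel_measurable (M \<Otimes>\<^sub>M N)" "h \<in> borel_measurable M"
    and K: "\<And>x. x \<in> space M \<Longrightarrow> (\<integral>\<^sup>+y. K x y \<partial>N) \<le> C"
  shows "(\<integral>\<^sup>+x. \<integral>\<^sup>+y. h x * K x y \<partial>N \<partial>M) \<le> C * (\<integral>\<^sup>+x. h x \<partial>M)"
proof -
  interpret sigma_finite_measure N
    by fact
  have "(\<integral>\<^sup>+x. \<integral>\<^sup>+y. h x * K x y \<partial>N \<partial>M) = (\<integral>\<^sup>+x. h x * (\<integral>\<^sup>+y. K x y \<partial>N) \<partial>M)"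
    by (intro nn_integral_cong nn_integral_cmult) measurable
  also have "\<dots> \<le> (\<integral>\<^sup>+x. h x * C \<partial>M)"
    by (intro nn_integral_mono mult_left_mono K) auto
  finally show ?thesis
    by (simp add: nn_integral_cmult mult.commute)
qed

lemma nn_integral_Schur_test:
  assumes "sigma_finite_measure M" "sigma_finite_measure N"
    and [measurable]: "case_prod K \<in> borel_measurable (M \<Otimes>\<^sub>M N)"
      "f \<in> borel_measurable M" "g \<in> borel_measurable N"
    and K: "\<And>x. x \<in> space M \<Longrightarrow> (\<integral>\<^sup>+y. K x y \<partial>N) \<le> C" "\<And>y. y \<in> space N \<Longrightarrow> (\<integral>\<^sup>+x. K x y \<partial>M) \<le> C"
  shows "2 * (\<integral>\<^sup>+x. \<integral>\<^sup>+y. f x * g y * K x y \<partial>N \<partial>M) \<le>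
      C * (\<integral>\<^sup>+x. (f x)\<^sup>2 \<partial>M) + C * (\<integral>\<^sup>+y. (g y)\<^sup>2 \<partial>N)"
proof -
  interpret pair_sigma_finite M N
    using assms(1,2) by (simp add: pair_sigma_finite_def)
  interpret flip: pair_sigma_finite N M
    using assms(1,2) by (simp add: pair_sigma_finite_def)
  have pointwise: "2 * (f x * g y * K x y) \<le> (f x)\<^sup>2 * K x y + (g y)\<^sup>2 * K x y" for x y
    using mult_right_mono[OF ennreal_sum_squares_bound[of "f x" "g y"], of "K x y"]
    by (simp add: distrib_right mult.assoc)
  have "2 * (\<integral>\<^sup>+x. \<integral>\<^sup>+y. f x * g y * K x y \<partial>N \<partial>M) = (\<integral>\<^sup>+x. 2 * (\<integral>\<^sup>+y. f x * g y * K x y \<partial>N) \<partial>M)"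
    by (rule nn_integral_cmult[symmetric]) measurable
  also have "\<dots> = (\<integral>\<^sup>+x. \<integral>\<^sup>+y. 2 * (f x * g y * K x y) \<partial>N \<partial>M)"
    by (intro nn_integral_cong nn_integral_cmult[symmetric]) measurable
  also have "\<dots> \<le> (\<integral>\<^sup>+x. \<integral>\<^sup>+y. (f x)\<^sup>2 * K x y + (g y)\<^sup>2 * K x y \<partial>N \<partial>M)"
    by (intro nn_integral_mono pointwise)
  also have "\<dots> = (\<integral>\<^sup>+x. (\<integral>\<^sup>+y. (f x)\<^sup>2 * K x y \<partial>N) + (\<integral>\<^sup>+y. (g y)\<^sup>2 * K x y \<partial>N) \<partial>M)"
    by (intro nn_integral_cong nn_integral_add) measurable
  also have "\<dots> = (\<integral>\<^sup>+x. \<integral>\<^sup>+y. (f x)\<^sup>2 * K x y \<partial>N \<partial>M) + (\<integral>\<^sup>+x. \<integral>\<^sup>+y. (g y)\<^sup>2 * K x y \<partial>N \<partial>M)"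
    by (rule nn_integral_add) measurable
  also have "(\<integral>\<^sup>+x. \<integral>\<^sup>+y. (g y)\<^sup>2 * K x y \<partial>N \<partial>M) = (\<integral>\<^sup>+y. \<integral>\<^sup>+x. (g y)\<^sup>2 * K x y \<partial>M \<partial>N)"
    by (rule Fubini'[symmetric]) measurable
  also have "(\<integral>\<^sup>+x. \<integral>\<^sup>+y. (f x)\<^sup>2 * K x y \<partial>N \<partial>M) + \<dots> \<le>
      C * (\<integral>\<^sup>+x. (f x)\<^sup>2 \<partial>M) + C * (\<integral>\<^sup>+y. (g y)\<^sup>2 \<partial>N)"
    by (intro add_mono nn_integral_kernel_le assms(1,2) K) measurable
  finally show ?thesis .
qed

lemma measurable_normal_density [measurable (raw)]:
  assumes [measurable]: "f \<in> borel_measurable M" "g \<in> borel_measurable M"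
  shows "(\<lambda>x. normal_density (f x) \<epsilon> (g x)) \<in> borel_measurable M"
  unfolding normal_density_def by measurable

lemma nn_integral_normal_kernel_le:
  fixes f :: "real \<Rightarrow> complex"
  assumes [measurable]: "f \<in> borel_measurable borel" and \<epsilon>: "\<epsilon> > 0"
  shows "(\<integral>\<^sup>+x. \<integral>\<^sup>+y. ennreal (cmod (f x) * cmod (f y)) *
        ennreal (normal_density x \<epsilon> y) \<partial>lborel \<partial>lborel)
    \<le> sqnorm lborel f" (is "?I \<le> _")
proof -
  have mass: "(\<integral>\<^sup>+y. ennreal (normal_density x \<epsilon> y) \<partial>lborel) = 1" for x
    using \<epsilon> by (subst nn_integral_eq_integral) auto
  have "normal_density x \<epsilon> y = normal_density y \<epsilon> x" for x y
    by (simp add: normal_density_def power2_commute)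
  then have mass': "(\<integral>\<^sup>+x. ennreal (normal_density x \<epsilon> y) \<partial>lborel) = 1" for y
    using mass[of y] by simp
  have "2 * (\<integral>\<^sup>+x. \<integral>\<^sup>+y. ennreal (cmod (f x)) * ennreal (cmod (f y)) *
        ennreal (normal_density x \<epsilon> y) \<partial>lborel \<partial>lborel) \<le>
      1 * (\<integral>\<^sup>+x. (ennreal (cmod (f x)))\<^sup>2 \<partial>lborel) + 1 * (\<integral>\<^sup>+y. (ennreal (cmod (f y)))\<^sup>2 \<partial>lborel)"
    by (rule nn_integral_Schur_test) (simp_all add: mass mass' lborel.sigma_finite_measure_axioms)
  then have "2 * ?I \<le> 2 * sqnorm lborel f"
    by (simp add: sqnorm_def ennreal_power ennreal_mult mult_2)
  then show ?thesis
    by (simp add: ennreal_mult_le_mult_iff)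
qed

lemma integral_gauss_mult_norm_fourier_integral_squared:
  assumes f: "integrable lborel f" and \<epsilon>: "\<epsilon> > 0"
  shows "complex_of_real (LINT \<xi>|lborel. gauss \<epsilon> \<xi> * (cmod (fourier_integral f \<xi>))\<^sup>2) =
    2 * pi * (LINT x|lborel. f x * cnj (LINT y|lborel. f y * of_real (normal_density x \<epsilon> y)))"
proof -
  let ?F = "fourier_integral f"
  define W where "W \<xi> = cnj (of_real (gauss \<epsilon> \<xi>) * ?F \<xi>)" for \<xi>
  have "integrable lborel (\<lambda>\<xi>. complex_of_real (gauss \<epsilon> \<xi>) * ?F \<xi>)"
    using \<epsilon> f
    by (intro integrable_mult_bounded[OF _ _ norm_fourier_integral_le] integrable_of_real
        integrable_gauss) auto
  then have W: "integrable lborel W"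
    unfolding W_def by (rule integrable_cnj)
  have "?F \<xi> * W \<xi> = of_real (gauss \<epsilon> \<xi> * (cmod (?F \<xi>))\<^sup>2)" for \<xi>
    by (simp add: W_def complex_norm_square[unfolded of_real_power] mult_ac)
  then have "complex_of_real (LINT \<xi>|lborel. gauss \<epsilon> \<xi> * (cmod (?F \<xi>))\<^sup>2) =
      (LINT \<xi>|lborel. ?F \<xi> * W \<xi>)"
    by (simp only: Bochner_Integration.integral_complex_of_real)
  also have "\<dots> = (LINT x|lborel. f x * fourier_integral W x)"
    by (rule fourier_integral_multiplication[OF f W])
  also have "\<dots> = (LINT x|lborel. 2 * pi *
      (f x * cnj (LINT y|lborel. f y * of_real (normal_density x \<epsilon> y))))"
    unfolding W_def fourier_integral_cnj fourier_integral_gauss_mult_fourier_integral[OF f \<epsilon>]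
    by (simp add: mult_ac del: Bochner_Integration.integral_cnj)
  finally show ?thesis
    by (simp only: integral_mult_right_zero)
qed

lemma gauss_weighted_sqnorm_fourier_integral_le:
  assumes f: "integrable lborel f" and \<epsilon>: "\<epsilon> > 0"
  shows "(\<integral>\<^sup>+\<xi>. ennreal (gauss \<epsilon> \<xi> * (cmod (fourier_integral f \<xi>))\<^sup>2) \<partial>lborel) \<le>
      ennreal (2 * pi) * sqnorm lborel f"
    (is "?G \<le> _")
proof -
  have [measurable]: "f \<in> borel_measurable borel"
    using f by auto
  let ?m = "\<lambda>x. LINT y|lborel. f y * of_real (normal_density x \<epsilon> y)"
  have "integrable lborel (\<lambda>\<xi>. gauss \<epsilon> \<xi> * (cmod (fourier_integral f \<xi>))\<^sup>2)"
    using \<epsilon>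
    by (intro integrable_mult_bounded[where B = "(LINT x|lborel. cmod (f x))\<^sup>2"] integrable_gauss)
      (auto intro!: power_mono norm_fourier_integral_le)
  then have "?G = ennreal (cmod (complex_of_real
      (LINT \<xi>|lborel. gauss \<epsilon> \<xi> * (cmod (fourier_integral f \<xi>))\<^sup>2)))"
    by (subst nn_integral_eq_integral) (auto simp: abs_of_nonneg)
  also have "\<dots> = ennreal (2 * pi) * ennreal (cmod (LINT x|lborel. f x * cnj (?m x)))"
    unfolding integral_gauss_mult_norm_fourier_integral_squared[OF f \<epsilon>] norm_mult
    by (subst ennreal_mult) auto
  also have "\<dots> \<le> ennreal (2 * pi) * sqnorm lborel f"
  proof (rule mult_left_mono)
    have "ennreal (cmod (LINT x|lborel. f x * cnj (?m x))) \<le>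
        (\<integral>\<^sup>+x. ennreal (cmod (f x * cnj (?m x))) \<partial>lborel)"
      by (rule ennreal_norm_integral_le)
    also have "\<dots> = (\<integral>\<^sup>+x. ennreal (cmod (f x)) * ennreal (cmod (?m x)) \<partial>lborel)"
      by (simp add: norm_mult ennreal_mult)
    also have "\<dots> \<le> (\<integral>\<^sup>+x. ennreal (cmod (f x)) *
        (\<integral>\<^sup>+y. ennreal (cmod (f y * of_real (normal_density x \<epsilon> y))) \<partial>lborel) \<partial>lborel)"
      by (intro nn_integral_mono mult_left_mono ennreal_norm_integral_le) simp
    also have "\<dots> = (\<integral>\<^sup>+x. \<integral>\<^sup>+y. ennreal (cmod (f x) * cmod (f y)) *
        ennreal (normal_density x \<epsilon> y) \<partial>lborel \<partial>lborel)"
      by (simp add: norm_mult ennreal_mult mult.assoc flip: nn_integral_cmult)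
    also have "\<dots> \<le> sqnorm lborel f"
      by (intro nn_integral_normal_kernel_le \<epsilon>) simp
    finally show "ennreal (cmod (LINT x|lborel. f x * cnj (?m x))) \<le> sqnorm lborel f" .
  qed simp
  finally show ?thesis .
qed

lemma sqnorm_fourier_integral_le:
  assumes f: "integrable lborel f"
  shows "sqnorm lborel (fourier_integral f) \<le> ennreal (2 * pi) * sqnorm lborel f"
proof -
  have [measurable]: "f \<in> borel_measurable borel"
    using f by auto
  let ?F = "fourier_integral f" and ?\<epsilon> = "\<lambda>n. inverse (real (Suc n))"
  have "(\<lambda>n. of_real (sqrt (gauss (?\<epsilon> n) \<xi>)) * ?F \<xi>) \<longlonglongrightarrow> ?F \<xi>" for \<xi>
    using tendsto_mult_right[OF tendsto_of_real[OF tendsto_real_sqrt[OF gauss_tendsto_1]]] by simp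
  then show ?thesis
  proof (intro sqnorm_le_if_AE_tendsto[where M = lborel and g = ?F] AE_I2 always_eventually allI)
    fix n
    have "sqnorm lborel (\<lambda>\<xi>. of_real (sqrt (gauss (?\<epsilon> n) \<xi>)) * ?F \<xi>) =
        (\<integral>\<^sup>+\<xi>. ennreal (gauss (?\<epsilon> n) \<xi> * (cmod (?F \<xi>))\<^sup>2) \<partial>lborel)"
      by (simp add: sqnorm_def norm_mult power_mult_distrib)
    also have "\<dots> \<le> ennreal (2 * pi) * sqnorm lborel f"
      by (intro gauss_weighted_sqnorm_fourier_integral_le f) simp
    finally show "sqnorm lborel (\<lambda>\<xi>. of_real (sqrt (gauss (?\<epsilon> n) \<xi>)) * ?F \<xi>) \<le>
        ennreal (2 * pi) * sqnorm lborel f" .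
  qed auto
qed

section \<open>The Fourier transform on \<open>L2\<close>\<close>

lemma L2_fourier_integral: "f \<in> L2 \<Longrightarrow> integrable lborel f \<Longrightarrow> fourier_integral f \<in> L2"
  using sqnorm_fourier_integral_le[of f]
  by (auto simp: L2_iff ennreal_mult_less_top
      intro: le_less_trans borel_measurable_fourier_integral)

definition cutoff :: "real \<Rightarrow> (real \<Rightarrow> complex) \<Rightarrow> real \<Rightarrow> complex" where
  "cutoff R f x = indicator {-R..R} x * f x"

lemma fourier_trunc_eq: "fourier_trunc R f = fourier_integral (cutoff R f)"
  by (auto simp: fourier_trunc_def fourier_integral_def cutoff_def set_lebesgue_integral_def
      fun_eq_iff cis_conv_exp indicator_def intro!: Bochner_Integration.integral_cong)

lemma L2_cutoff: "f \<in> L2 \<Longrightarrow> cutoff R f \<in> L2"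
  unfolding cutoff_def[abs_def] by (rule L2_mult_bounded[where B = 1]) (auto simp: indicator_def)

lemma integrable_cutoff: "f \<in> L2 \<Longrightarrow> integrable lborel (cutoff R f)"
  unfolding cutoff_def[abs_def]
  by (intro L2_mult_integrable L2_indicator) (auto simp: emeasure_lborel_Icc_eq)

lemma L2_fourier_trunc: "f \<in> L2 \<Longrightarrow> fourier_trunc R f \<in> L2"
  unfolding fourier_trunc_eq by (intro L2_fourier_integral L2_cutoff integrable_cutoff)

lemma tendsto_L2_cutoff:
  assumes f: "f \<in> L2"
  shows "tendsto_L2 lborel (\<lambda>R. cutoff R f) f at_top"
proof -
  have [measurable]: "cutoff R f \<in> borel_measurable borel" "f \<in> borel_measurable borel" for R
    using f L2_cutoff[OF f, of R] by measurable
  have int: "integrable lborel (\<lambda>x. (cmod (f x))\<^sup>2)"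
    using f by (simp add: L2_def)
  have dominated: "(cmod (f x - cutoff R f x))\<^sup>2 \<le> (cmod (f x))\<^sup>2" for x R
    by (auto simp: cutoff_def indicator_def)
  have "((\<lambda>R. LINT x|lborel. (cmod (f x - cutoff R f x))\<^sup>2) \<longlongrightarrow>
      integral\<^sup>L lborel (\<lambda>x::real. 0::real)) at_top"
  proof (rule integral_dominated_convergence_at_top[OF _ _ int])
    show "AE x in lborel. ((\<lambda>R. (cmod (f x - cutoff R f x))\<^sup>2) \<longlongrightarrow> 0) at_top"
    proof (intro AE_I2 tendsto_eventually)
      fix x
      show "\<forall>\<^sub>F R in at_top. (cmod (f x - cutoff R f x))\<^sup>2 = 0"
        using eventually_ge_at_top[of "\<bar>x\<bar>"]
        by eventually_elim (auto simp: cutoff_def indicator_def)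
    qed
  qed (use dominated in auto)
  moreover have "sqnorm lborel (\<lambda>x. f x - cutoff R f x) =
      ennreal (LINT x|lborel. (cmod (f x - cutoff R f x))\<^sup>2)" for R
    unfolding sqnorm_def using L2_diff[OF f L2_cutoff[OF f, of R]]
    by (intro nn_integral_eq_integral) (auto simp: L2_def)
  ultimately show ?thesis
    by (simp add: tendsto_L2_def flip: ennreal_0)
qed

lemma sqnorm_fourier_trunc_diff_le:
  assumes f: "f \<in> L2" and "R \<le> S"
  shows "sqnorm lborel (\<lambda>\<xi>. fourier_trunc S f \<xi> - fourier_trunc R f \<xi>) \<le>
    ennreal (2 * pi) * sqnorm lborel (\<lambda>x. f x - cutoff R f x)"
proof -
  have "sqnorm lborel (\<lambda>\<xi>. fourier_trunc S f \<xi> - fourier_trunc R f \<xi>) =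
      sqnorm lborel (fourier_integral (\<lambda>x. cutoff S f x - cutoff R f x))"
    by (simp add: fourier_trunc_eq fourier_integral_diff integrable_cutoff f)
  also have "\<dots> \<le> ennreal (2 * pi) * sqnorm lborel (\<lambda>x. cutoff S f x - cutoff R f x)"
    by (intro sqnorm_fourier_integral_le Bochner_Integration.integrable_diff integrable_cutoff f)
  also have "\<dots> \<le> ennreal (2 * pi) * sqnorm lborel (\<lambda>x. f x - cutoff R f x)"
    using assms L2_measurable[OF L2_diff[OF f L2_cutoff[OF f]]]
    by (intro mult_left_mono sqnorm_mono_AE) (auto simp: cutoff_def indicator_def)
  finally show ?thesis .
qed

lemma
  assumes f: "f \<in> L2"
  shows L2_fourier: "fourier f \<in> L2"
    and tendsto_L2_fourier: "tendsto_L2 lborel (\<lambda>R. fourier_trunc R f) (fourier f) at_top"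
proof -
  have "((\<lambda>R. ennreal (2 * pi) * sqnorm lborel (\<lambda>x. f x - cutoff R f x)) \<longlongrightarrow> 0) at_top"
    using tendsto_L2_cutoff[OF f] ennreal_tendsto_cmult[of "ennreal (2 * pi)"]
    unfolding tendsto_L2_def by fastforce
  then have "\<exists>g\<in>L2. tendsto_L2 lborel (\<lambda>R. fourier_trunc R f) g at_top"
    by (rule L2_complete[OF L2_fourier_trunc[OF f] _ sqnorm_fourier_trunc_diff_le[OF f]])
  then have "\<exists>g. g \<in> L2 \<and> tendsto_L2 lborel (\<lambda>R. fourier_trunc R f) g at_top"
    by blast
  from someI_ex[OF this] show "fourier f \<in> L2"
    "tendsto_L2 lborel (\<lambda>R. fourier_trunc R f) (fourier f) at_top"
    by (simp_all add: fourier_def tendsto_L2_def sqnorm_def)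
qed

lemma measurable_fourier: "f \<in> L2 \<Longrightarrow> fourier f \<in> borel_measurable borel"
  by (intro L2_measurable L2_fourier)

lemma fourier_eqI:
  assumes "f \<in> L2" "g \<in> borel_measurable borel" "tendsto_L2 lborel (\<lambda>R. fourier_trunc R f) g at_top"
  shows "AE \<xi> in lborel. fourier f \<xi> = g \<xi>"
  by (rule tendsto_L2_unique[OF _ _ _ _ tendsto_L2_fourier[OF assms(1)] assms(3)])
     (use assms L2_measurable[OF L2_fourier_trunc[OF assms(1)]] in \<open>auto intro: measurable_fourier\<close>)

lemma fourier_eq_fourier_integral:
  assumes f: "f \<in> L2" "integrable lborel f"
  shows "AE \<xi> in lborel. fourier f \<xi> = fourier_integral f \<xi>"
proof (rule fourier_eqI[OF f(1)])
  show "fourier_integral f \<in> borel_measurable borel"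
    by (intro L2_measurable L2_fourier_integral f)
  have "sqnorm lborel (\<lambda>\<xi>. fourier_integral f \<xi> - fourier_trunc R f \<xi>) \<le>
      ennreal (2 * pi) * sqnorm lborel (\<lambda>x. f x - cutoff R f x)" for R
    using sqnorm_fourier_integral_le[of "\<lambda>x. f x - cutoff R f x"] f integrable_cutoff[OF f(1), of R]
    by (simp add: fourier_trunc_eq fourier_integral_diff)
  with tendsto_L2_cutoff[OF f(1)]
  show "tendsto_L2 lborel (\<lambda>R. fourier_trunc R f) (fourier_integral f) at_top"
    by (rule tendsto_L2_dominated)
qed

lemma fourier_cong_AE:
  assumes [measurable]: "f \<in> borel_measurable borel" "g \<in> borel_measurable borel"
    and eq: "AE x in lborel. f x = g x"
  shows "fourier f = fourier g"
proof -
  have "fourier_trunc R f = fourier_trunc R g" for R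
    unfolding fourier_trunc_def set_lebesgue_integral_def fun_eq_iff
    by (intro allI integral_cong_AE) (use eq in \<open>auto elim: eventually_mono\<close>)
  then show ?thesis
    by (simp add: fourier_def)
qed

lemma fourier_add:
  assumes f: "f \<in> L2" and g: "g \<in> L2"
  shows "AE \<xi> in lborel. fourier (\<lambda>x. f x + g x) \<xi> = fourier f \<xi> + fourier g \<xi>"
proof (rule fourier_eqI)
  have "fourier_trunc R (\<lambda>x. f x + g x) \<xi> = fourier_trunc R f \<xi> + fourier_trunc R g \<xi>" for R \<xi>
    using integrable_mult_cis[OF integrable_cutoff[OF f]]
      integrable_mult_cis[OF integrable_cutoff[OF g]]
    by (simp add: fourier_trunc_eq fourier_integral_def cutoff_def distrib_left distrib_right)
  then have "fourier_trunc R (\<lambda>x. f x + g x) =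
      (\<lambda>\<xi>. fourier_trunc R f \<xi> + fourier_trunc R g \<xi>)" for R
    by (simp add: fun_eq_iff)
  then show "tendsto_L2 lborel (\<lambda>R. fourier_trunc R (\<lambda>x. f x + g x))
      (\<lambda>\<xi>. fourier f \<xi> + fourier g \<xi>) at_top"
    using f g tendsto_L2_add[OF _ _ _ _ tendsto_L2_fourier[OF f] tendsto_L2_fourier[OF g]]
    by (simp add: L2_measurable L2_fourier_trunc measurable_fourier)
qed (use f g in \<open>auto intro: L2_add L2_measurable L2_fourier\<close>)

lemma fourier_eq_lipschitz_affine:
  assumes f: "f \<in> L2" and g: "g \<in> L2" and "\<bar>b\<bar> = 1"
    and lipschitz: "B-lipschitz_on UNIV \<Phi>"
    and trunc: "\<And>R \<xi>. fourier_trunc R g \<xi> = \<Phi> (fourier_trunc R f (a + b * \<xi>))"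
  shows "AE \<xi> in lborel. fourier g \<xi> = \<Phi> (fourier f (a + b * \<xi>))"
proof (rule fourier_eqI[OF g])
  have [measurable]: "\<Phi> \<in> borel_measurable borel" "fourier f \<in> borel_measurable borel"
      "fourier_trunc R f \<in> borel_measurable borel" for R
    using lipschitz_on_continuous_on[OF lipschitz] measurable_fourier[OF f]
      L2_measurable[OF L2_fourier_trunc[OF f]]
    by (auto intro: borel_measurable_continuous_onI)
  show "(\<lambda>\<xi>. \<Phi> (fourier f (a + b * \<xi>))) \<in> borel_measurable borel"
    by measurable
  have "sqnorm lborel (\<lambda>\<xi>. \<Phi> (fourier f (a + b * \<xi>)) - fourier_trunc R g \<xi>) \<le>
      ennreal (B\<^sup>2) * sqnorm lborel (\<lambda>\<xi>. fourier f \<xi> - fourier_trunc R f \<xi>)" for R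
  proof -
    have "sqnorm lborel (\<lambda>\<xi>. \<Phi> (fourier f (a + b * \<xi>)) - fourier_trunc R g \<xi>) \<le>
        ennreal (B\<^sup>2) * sqnorm lborel (\<lambda>\<xi>. fourier f (a + b * \<xi>) - fourier_trunc R f (a + b * \<xi>))"
      using lipschitz_onD[OF lipschitz] by (intro sqnorm_le_AE AE_I2) (auto simp: trunc dist_norm)
    then show ?thesis
      using sqnorm_lborel_affine[of "\<lambda>\<xi>. fourier f \<xi> - fourier_trunc R f \<xi>" b a] \<open>\<bar>b\<bar> = 1\<close>
      by fastforce
  qed
  with tendsto_L2_fourier[OF f]
  show "tendsto_L2 lborel (\<lambda>R. fourier_trunc R g) (\<lambda>\<xi>. \<Phi> (fourier f (a + b * \<xi>))) at_top"
    by (rule tendsto_L2_dominated)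
qed

lemma fourier_cmult:
  assumes f: "f \<in> L2"
  shows "AE \<xi> in lborel. fourier (\<lambda>x. c * f x) \<xi> = c * fourier f \<xi>"
proof -
  have "fourier_trunc R (\<lambda>x. c * f x) \<xi> = c * fourier_trunc R f (0 + 1 * \<xi>)" for R \<xi>
    by (simp add: fourier_trunc_eq fourier_integral_def cutoff_def mult_ac
      flip: integral_mult_right_zero)
  from fourier_eq_lipschitz_affine[OF f L2_cmult[OF f] _ _ this, of "cmod c"] show ?thesis
    by (simp add: lipschitz_on_def dist_norm norm_mult flip: right_diff_distrib)
qed

lemma fourier_reflect:
  assumes f: "f \<in> L2"
  shows "AE \<xi> in lborel. fourier (\<lambda>x. f (- x)) \<xi> = fourier f (- \<xi>)"
proof -
  have "fourier_trunc R (\<lambda>x. f (- x)) \<xi> = id (fourier_trunc R f (0 + (-1) * \<xi>))" for R \<xi>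
    unfolding fourier_trunc_eq fourier_integral_def
    by (subst lborel_integral_real_affine[of "-1" _ 0])
       (auto simp: cutoff_def indicator_def intro!: Bochner_Integration.integral_cong)
  from fourier_eq_lipschitz_affine[OF f L2_reflect[OF f] _ _ this, of 1] show ?thesis
    by (simp add: lipschitz_on_def)
qed

lemma fourier_cnj:
  assumes f: "f \<in> L2"
  shows "AE \<xi> in lborel. fourier (\<lambda>x. cnj (f x)) \<xi> = cnj (fourier f (- \<xi>))"
proof -
  have "cutoff R (\<lambda>x. cnj (f x)) = (\<lambda>x. cnj (cutoff R f x))" for R
    by (auto simp: cutoff_def indicator_def)
  then have "fourier_trunc R (\<lambda>x. cnj (f x)) \<xi> = cnj (fourier_trunc R f (0 + (-1) * \<xi>))" for R \<xi>
    by (simp add: fourier_trunc_eq fourier_integral_cnj)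
  from fourier_eq_lipschitz_affine[OF f L2_cnj[OF f] _ _ this, of 1] show ?thesis
    by (simp add: lipschitz_on_def dist_norm flip: complex_cnj_diff)
qed

lemma L2_modulate: "f \<in> L2 \<Longrightarrow> (\<lambda>x. cis (- (x * a)) * f x) \<in> L2"
  by (rule L2_mult_bounded[where B = 1]) auto

lemma fourier_modulate:
  assumes f: "f \<in> L2"
  shows "AE \<xi> in lborel. fourier (\<lambda>x. cis (- (x * a)) * f x) \<xi> = fourier f (a + \<xi>)"
proof -
  have "cutoff R (\<lambda>x. cis (- (x * a)) * f x) = (\<lambda>x. cis (- (x * a)) * cutoff R f x)" for R
    by (auto simp: cutoff_def)
  then have "fourier_trunc R (\<lambda>x. cis (- (x * a)) * f x) \<xi> =
      id (fourier_trunc R f (a + 1 * \<xi>))" for R \<xi>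
    by (simp add: fourier_trunc_eq fourier_integral_modulate)
  from fourier_eq_lipschitz_affine[OF f L2_modulate[OF f] _ _ this, of 1] show ?thesis
    by (simp add: lipschitz_on_def)
qed

lemma L2_tendsto_integral_mult:
  assumes "\<And>i. f i \<in> L2" "g \<in> L2" "h \<in> L2" "tendsto_L2 lborel f g F"
  shows "((\<lambda>i. LINT x|lborel. f i x * h x) \<longlongrightarrow> (LINT x|lborel. g x * h x)) F"
  using assms by (intro tendsto_L2_integral_mult L2_mult_integrable) (auto simp: L2_iff)

theorem fourier_multiplication:
  assumes f: "f \<in> L2" and g: "g \<in> L2"
  shows "(LINT \<xi>|lborel. fourier f \<xi> * g \<xi>) = (LINT x|lborel. f x * fourier g x)"
proof -
  have trunc_trunc: "(LINT \<xi>|lborel. fourier_trunc R f \<xi> * cutoff S g \<xi>) =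
      (LINT x|lborel. cutoff R f x * fourier_trunc S g x)" for R S
    unfolding fourier_trunc_eq by (intro fourier_integral_multiplication integrable_cutoff f g)
  have trunc: "(LINT \<xi>|lborel. cutoff S g \<xi> * fourier f \<xi>) =
      (LINT x|lborel. fourier_trunc S g x * f x)" for S
  proof -
    have "((\<lambda>R. LINT \<xi>|lborel. fourier_trunc R f \<xi> * cutoff S g \<xi>) \<longlongrightarrow>
        (LINT \<xi>|lborel. fourier f \<xi> * cutoff S g \<xi>)) at_top"
      by (intro L2_tendsto_integral_mult L2_fourier L2_cutoff L2_fourier_trunc
        tendsto_L2_fourier f g)
    moreover have "((\<lambda>R. LINT \<xi>|lborel. fourier_trunc R f \<xi> * cutoff S g \<xi>) \<longlongrightarrow>
        (LINT x|lborel. f x * fourier_trunc S g x)) at_top"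
      unfolding trunc_trunc by (intro L2_tendsto_integral_mult L2_cutoff L2_fourier_trunc
        tendsto_L2_cutoff f g)
    ultimately have "(LINT \<xi>|lborel. fourier f \<xi> * cutoff S g \<xi>) =
        (LINT x|lborel. f x * fourier_trunc S g x)"
      by (rule tendsto_unique[OF trivial_limit_at_top_linorder])
    then show ?thesis by (simp add: mult.commute)
  qed
  have "((\<lambda>S. LINT \<xi>|lborel. cutoff S g \<xi> * fourier f \<xi>) \<longlongrightarrow>
      (LINT \<xi>|lborel. g \<xi> * fourier f \<xi>)) at_top"
    by (intro L2_tendsto_integral_mult L2_fourier L2_cutoff tendsto_L2_cutoff f g)
  moreover have "((\<lambda>S. LINT \<xi>|lborel. cutoff S g \<xi> * fourier f \<xi>) \<longlongrightarrow>
      (LINT x|lborel. fourier g x * f x)) at_top"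
    unfolding trunc by (intro L2_tendsto_integral_mult L2_fourier L2_fourier_trunc
      tendsto_L2_fourier f g)
  ultimately have "(LINT \<xi>|lborel. g \<xi> * fourier f \<xi>) = (LINT x|lborel. fourier g x * f x)"
    by (rule tendsto_unique[OF trivial_limit_at_top_linorder])
  then show ?thesis
    by (simp add: mult.commute)
qed

section \<open>Fourier inversion\<close>

lemma AE_lborel_reflect:
  assumes "AE x in lborel. P (x::real)"
  shows "AE x in lborel. P (- x)"
  using AE_distrD[of uminus lborel borel P, unfolded lborel_distr_uminus] assms by simp

lemma AE_lborel_shift:
  assumes "AE x in lborel. P (x::real)"
  shows "AE x in lborel. P (a + x)"
  using AE_distrD[of "(+) a" lborel borel P, unfolded lborel_distr_plus] assms by simp

lemma AE_eq_0_of_Int_stable_generator: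
  fixes f :: "'a \<Rightarrow> 'b::{banach, second_countable_topology}"
  assumes M: "sigma_finite_measure M" "sets M = sigma_sets (space M) E"
      "Int_stable E" "E \<subseteq> Pow (space M)"
    and f: "integrable M f" "(LINT x|M. f x) = 0" "\<And>A. A \<in> E \<Longrightarrow> (LINT x:A|M. f x) = 0"
  shows "AE x in M. f x = 0"
proof (rule sigma_finite_measure.density_zero[OF M(1) f(1)])
  have int: "set_integrable M A f" if "A \<in> sets M" for A
    using f(1) that unfolding set_integrable_def by (intro integrable_mult_indicator)
  fix A assume "A \<in> sets M"
  then have "A \<in> sigma_sets (space M) E"
    by (simp add: M(2))
  with M(3,4) show "(LINT x:A|M. f x) = 0"
  proof (induction rule: sigma_sets_induct_disjoint)
    case (basic A)
    then show ?case by (rule f(3))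
  next
    case empty
    then show ?case by (simp add: set_lebesgue_integral_def)
  next
    case (compl A)
    then have A: "A \<in> sets M"
      by (simp add: M(2))
    have "(LINT x:space M|M. f x) = (LINT x:A \<union> (space M - A)|M. f x)"
      using sets.sets_into_space[OF A] by (simp add: Un_absorb1)
    also have "\<dots> = (LINT x:A|M. f x) + (LINT x:space M - A|M. f x)"
      using A by (intro set_integral_Un int) auto
    finally show ?case
      using compl(2) f(1,2) by (simp add: set_integral_space)
  next
    case (union A)
    then have "A i \<in> sets M" for i
      by (auto simp: M(2))
    then have "(LINT x:(\<Union>i. A i)|M. f x) = (\<Sum>i. (LINT x:A i|M. f x))"
      using union(1)
      by (intro lebesgue_integral_countable_add int sets.countable_UN)
        (auto simp: disjoint_family_on_def)
    then show ?case
      using union(3) by simp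
  qed
qed

lemma AE_eq_0_of_Icc_integrals_eq_0:
  fixes f :: "real \<Rightarrow> 'b::{banach, second_countable_topology}"
  assumes int: "\<And>a b. set_integrable lborel {a..b} f"
    and zero: "\<And>a b. a \<le> b \<Longrightarrow> (LINT x:{a..b}|lborel. f x) = 0"
  shows "AE x in lborel. f x = 0"
proof -
  have "AE x in lborel. indicator {-real n..real n} x *\<^sub>R f x = 0" for n
  proof (rule AE_eq_0_of_Int_stable_generator[where E = "range (\<lambda>a. {..a})"])
    show "sets lborel = sigma_sets (space lborel) (range (\<lambda>a::real. {..a}))"
      by (simp add: borel_eq_atMost)
    show "Int_stable (range (\<lambda>a::real. {..a}))"
      by (auto simp: Int_stable_def)
    show "integrable lborel (\<lambda>x. indicator {-real n..real n} x *\<^sub>R f x)"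
      using int unfolding set_integrable_def .
    show "(LINT x|lborel. indicator {-real n..real n} x *\<^sub>R f x) = 0"
      using zero[of "-real n" "real n"] by (simp add: set_lebesgue_integral_def)
    fix A assume "A \<in> range (\<lambda>a::real. {..a})"
    then obtain a where "A = {..a}" by blast
    then have "(LINT x:A|lborel. indicator {-real n..real n} x *\<^sub>R f x) =
        (LINT x:{-real n..min a (real n)}|lborel. f x)"
      unfolding set_lebesgue_integral_def
      by (intro Bochner_Integration.integral_cong) (auto simp: indicator_def)
    also have "\<dots> = 0"
      using zero[of "-real n" "min a (real n)"]
      by (cases "-real n \<le> min a (real n)") (simp_all add: set_lebesgue_integral_def)
    finally show "(LINT x:A|lborel. indicator {-real n..real n} x *\<^sub>R f x) = 0" .
  qed (simp_all add: lborel.sigma_finite_measure_axioms)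
  then have "AE x in lborel. \<forall>n. indicator {-real n..real n} x *\<^sub>R f x = 0"
    unfolding AE_all_countable by blast
  then show ?thesis
  proof eventually_elim
    case (elim x)
    obtain n :: nat where "\<bar>x\<bar> \<le> real n"
      using real_arch_simple by blast
    then show ?case
      using elim[rule_format, of n] by (simp add: indicator_def abs_le_iff)
  qed
qed

lemma fourier_integral_indicator_Icc:
  assumes "a \<le> b" "t \<noteq> 0"
  shows "fourier_integral (indicator {a..b}) t = (iexp (- (t * a)) - iexp (- (t * b))) / (\<i> * t)"
proof -
  let ?F = "\<lambda>x. iexp (- (t * x)) / (- \<i> * t)"
  have "(?F has_vector_derivative cis (- (x * t))) (at x within {a..b})" for x
    using assms(2)
    by (auto intro!: derivative_eq_intros has_vector_derivative_real_field
        simp: cis_conv_exp mult_ac)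
  then have "(LINT x|lborel. indicator {a..b} x *\<^sub>R cis (- (x * t))) = ?F b - ?F a"
    using assms(1) by (intro integral_FTC_Icc continuous_intros)
  also have "(LINT x|lborel. indicator {a..b} x *\<^sub>R cis (- (x * t))) =
      fourier_integral (indicator {a..b}) t"
    unfolding fourier_integral_def
    by (intro Bochner_Integration.integral_cong) (auto simp: indicator_def)
  finally show ?thesis
    using assms(2) by (simp add: field_simps)
qed

text \<open>This is Levy's inversion formula for the Dirac measure at \<open>x\<close>.\<close>

lemma fourier_trunc_fourier_integral_indicator_tendsto:
  assumes "a \<le> b" "x \<noteq> a" "x \<noteq> b"
  shows "(\<lambda>n. fourier_trunc (real n) (fourier_integral (indicator {a..b})) (- x)) \<longlonglongrightarrow>
      2 * complex_of_real pi * indicator {a..b} x"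
proof -
  interpret real_distribution "return borel x"
    by (simp add: real_distribution_def real_distribution_axioms_def prob_space_return)
  let ?\<phi> = "\<lambda>t. (iexp (- (t * a)) - iexp (- (t * b))) / (\<i> * t) * iexp (t * x)"
  have char_return: "char (return borel x) t = iexp (t * x)" for t
    by (simp add: char_def integral_return)
  have "(\<lambda>n. 1 / (2 * pi) * (CLBINT t=-real n..real n. ?\<phi> t)) \<longlonglongrightarrow>
      complex_of_real (measure (return borel x) {a<..b})"
    using Levy_Inversion[OF assms(1)] assms(2,3) by (simp add: char_return measure_return)
  also have "complex_of_real (measure (return borel x) {a<..b}) = indicator {a..b} x"
    using assms by (simp add: measure_return indicator_def)
  finally have "(\<lambda>n. 1 / (2 * pi) * (CLBINT t=-real n..real n. ?\<phi> t)) \<longlonglongrightarrow> indicator {a..b} x" .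
  from tendsto_mult_left[OF this, of "2 * complex_of_real pi"]
  have "(\<lambda>n. CLBINT t=-real n..real n. ?\<phi> t) \<longlonglongrightarrow> 2 * complex_of_real pi * indicator {a..b} x"
    by simp
  moreover have "fourier_trunc (real n) (fourier_integral (indicator {a..b})) (- x) =
      (CLBINT t=-real n..real n. ?\<phi> t)" for n
  proof -
    have "AE t in lborel. t \<notin> {0, - real n, real n}"
      by (intro AE_not_in finite_imp_null_set_lborel) simp
    then have "AE t in lborel. indicator {-real n..real n} t *\<^sub>R
        (fourier_integral (indicator {a..b}) t * exp (- (\<i> * of_real (t * - x)))) =
        indicator {-real n<..<real n} t *\<^sub>R ?\<phi> t"
      by eventually_elim (auto simp: fourier_integral_indicator_Icc[OF assms(1)] indicator_def)
    then have "fourier_trunc (real n) (fourier_integral (indicator {a..b})) (- x) =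
        (LINT t|lborel. indicator {-real n<..<real n} t *\<^sub>R ?\<phi> t)"
      unfolding fourier_trunc_def set_lebesgue_integral_def
      by (rule integral_cong_AE[rotated 2]) measurable
    then show ?thesis
      by (simp add: interval_lebesgue_integral_def set_lebesgue_integral_def)
  qed
  ultimately show ?thesis by simp
qed

lemma integral_lborel_reflect:
  fixes f :: "real \<Rightarrow> 'b::{banach, second_countable_topology}"
  shows "(LINT x|lborel. f (- x)) = (LINT x|lborel. f x)"
  using lborel_integral_real_affine[of "-1" f 0] by simp

lemma L2_indicator_Icc: "indicator {a..b} \<in> L2"
  by (intro L2_indicator) (auto simp: emeasure_lborel_Icc_eq)

lemma fourier_fourier_indicator_Icc:
  assumes "a \<le> b"
  shows "AE x in lborel. fourier (fourier (indicator {a..b})) (- x) =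
      2 * of_real pi * indicator {a..b} x"
proof -
  let ?F = "fourier_integral (indicator {a..b})"
  have int: "integrable lborel (indicator {a..b} :: real \<Rightarrow> complex)"
    using L2_mult_integrable[OF L2_indicator_Icc L2_indicator_Icc, of a b a b]
    by (simp flip: indicator_inter_arith)
  have F: "?F \<in> L2" "fourier ?F \<in> L2"
    by (intro L2_fourier L2_fourier_integral L2_indicator_Icc int)+
  have [measurable]: "fourier ?F \<in> borel_measurable borel"
      "fourier_trunc R ?F \<in> borel_measurable borel" for R
    using F by (auto intro: L2_measurable L2_fourier_trunc)
  have "AE \<xi> in lborel. \<xi> \<noteq> - a \<and> \<xi> \<noteq> - b"
    by (intro AE_conjI AE_lborel_singleton)
  then have "AE \<xi> in lborel. (\<lambda>n. fourier_trunc (real n) ?F \<xi>) \<longlonglongrightarrow>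
      2 * of_real pi * indicator {a..b} (- \<xi>)"
  proof eventually_elim
    case (elim \<xi>)
    then show ?case
      using fourier_trunc_fourier_integral_indicator_tendsto[OF assms, of "- \<xi>"] by auto
  qed
  moreover have "tendsto_L2 lborel (\<lambda>n. fourier_trunc (real n) ?F) (fourier ?F) sequentially"
    using filterlim_compose[OF tendsto_L2_fourier[OF F(1), unfolded tendsto_L2_def]
        filterlim_real_sequentially]
    by (simp add: tendsto_L2_def)
  ultimately have "AE \<xi> in lborel. fourier ?F \<xi> = 2 * of_real pi * indicator {a..b} (- \<xi>)"
    by (intro tendsto_L2_AE_unique[of "\<lambda>n. fourier_trunc (real n) ?F"]) measurable
  from AE_lborel_reflect[OF this]
  have "AE x in lborel. fourier ?F (- x) = 2 * of_real pi * indicator {a..b} x"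
    by simp
  moreover have "fourier (fourier (indicator {a..b})) = fourier ?F"
    by (intro fourier_cong_AE fourier_eq_fourier_integral L2_indicator_Icc int
        measurable_fourier L2_measurable F)
  ultimately show ?thesis by simp
qed

lemma integral_fourier_fourier_reflect_mult:
  assumes f: "f \<in> L2" and h: "h \<in> L2"
  shows "(LINT x|lborel. fourier (fourier f) (- x) * h x) =
    (LINT x|lborel. f x * fourier (fourier (\<lambda>x. h (- x))) x)"
proof -
  have "(LINT x|lborel. fourier (fourier f) (- x) * h x) =
      (LINT x|lborel. fourier (fourier f) x * h (- x))"
    using integral_lborel_reflect[of "\<lambda>x. fourier (fourier f) x * h (- x)"] by simp
  also have "\<dots> = (LINT x|lborel. f x * fourier (fourier (\<lambda>x. h (- x))) x)"
    by (simp add: fourier_multiplication L2_fourier L2_reflect f h)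
  finally show ?thesis .
qed

theorem fourier_fourier:
  assumes f: "f \<in> L2"
  shows "AE x in lborel. fourier (fourier f) (- x) = 2 * of_real pi * f x"
proof -
  have F: "fourier f \<in> L2" "fourier (fourier f) \<in> L2"
    using f by (auto intro: L2_fourier)
  define d where "d x = fourier (fourier f) (- x) - 2 * of_real pi * f x" for x
  have d: "d \<in> L2"
    unfolding d_def by (intro L2_diff L2_reflect F L2_cmult f)
  have "AE x in lborel. d x = 0"
  proof (rule AE_eq_0_of_Icc_integrals_eq_0)
    fix a b :: real
    show "set_integrable lborel {a..b} d"
      using L2_mult_integrable[OF L2_indicator_Icc d, of a b] unfolding set_integrable_def
      by (rule Bochner_Integration.integrable_cong[THEN iffD1, rotated 2])
        (auto simp: indicator_def)
    assume "a \<le> b"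
    let ?h = "indicator {a..b} :: real \<Rightarrow> complex"
    have h: "?h \<in> L2" "(\<lambda>x. ?h (- x)) \<in> L2"
      by (intro L2_reflect L2_indicator_Icc)+
    have "(\<lambda>x. ?h (- x)) = indicator {-b..-a}"
      by (auto simp: fun_eq_iff indicator_def)
    then have FFh: "AE x in lborel. fourier (fourier (\<lambda>x. ?h (- x))) x = 2 * of_real pi * ?h x"
      using AE_lborel_reflect[OF fourier_fourier_indicator_Icc[of "-b" "-a"]] \<open>a \<le> b\<close>
      by (auto simp: indicator_def elim!: eventually_mono)
    have "(LINT x|lborel. fourier (fourier f) (- x) * ?h x) =
        (LINT x|lborel. f x * fourier (fourier (\<lambda>x. ?h (- x))) x)"
      by (rule integral_fourier_fourier_reflect_mult[OF f h(1)])
    also have "\<dots> = (LINT x|lborel. 2 * of_real pi * f x * ?h x)"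
      using FFh f h
      by (intro integral_cong_AE)
        (auto elim: eventually_mono intro: borel_measurable_times L2_measurable L2_fourier)
    finally have "(LINT x|lborel. d x * ?h x) = 0"
      using L2_mult_integrable[OF L2_reflect[OF F(2)] h(1)]
        L2_mult_integrable[OF L2_cmult[OF f] h(1)]
      by (simp add: d_def left_diff_distrib)
    also have "(LINT x|lborel. d x * ?h x) = (LINT x:{a..b}|lborel. d x)"
      unfolding set_lebesgue_integral_def
      by (intro Bochner_Integration.integral_cong) (auto simp: indicator_def)
    finally show "(LINT x:{a..b}|lborel. d x) = 0" .
  qed
  then show ?thesis by (simp add: d_def)
qed

lemma L2_inv_fourier: "g \<in> L2 \<Longrightarrow> inv_fourier g \<in> L2"
  unfolding inv_fourier_def[abs_def] by (intro L2_cmult L2_reflect L2_fourier)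

lemma inv_fourier_fourier:
  assumes "f \<in> L2"
  shows "AE x in lborel. inv_fourier (fourier f) x = f x"
  using fourier_fourier[OF assms] by eventually_elim (simp add: inv_fourier_def)

lemma fourier_inv_fourier:
  assumes g: "g \<in> L2"
  shows "AE \<xi> in lborel. fourier (inv_fourier g) \<xi> = g \<xi>"
  using fourier_cmult[OF L2_reflect[OF L2_fourier[OF g]], of "1 / (2 * of_real pi)"]
    fourier_reflect[OF L2_fourier[OF g]] fourier_fourier[OF g]
  by eventually_elim (simp add: inv_fourier_def[abs_def])

lemma inv_fourier_cong_AE:
  assumes "f \<in> borel_measurable borel" "g \<in> borel_measurable borel" "AE x in lborel. f x = g x"
  shows "inv_fourier f = inv_fourier g"
  using fourier_cong_AE[OF assms] by (simp add: inv_fourier_def fun_eq_iff)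

lemma inv_fourier_eq_fourier_integral:
  assumes "g \<in> L2" "integrable lborel g"
  shows "AE x in lborel. inv_fourier g x = 1 / (2 * of_real pi) * fourier_integral g (- x)"
  using AE_lborel_reflect[OF fourier_eq_fourier_integral[OF assms]]
  by eventually_elim (simp add: inv_fourier_def)

lemma AE_eq_if_fourier_AE_eq:
  assumes f: "f \<in> L2" and g: "g \<in> L2" and eq: "AE \<xi> in lborel. fourier f \<xi> = fourier g \<xi>"
  shows "AE x in lborel. f x = g x"
  using inv_fourier_fourier[OF f] inv_fourier_fourier[OF g]
  unfolding inv_fourier_cong_AE[OF measurable_fourier[OF f] measurable_fourier[OF g] eq]
  by eventually_elim simp

definition L2_inner :: "(real \<Rightarrow> complex) \<Rightarrow> (real \<Rightarrow> complex) \<Rightarrow> complex" where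
  "L2_inner f g = (LINT x|lborel. f x * cnj (g x))"

lemma L2_inner_cong_AE:
  assumes [measurable]: "f \<in> borel_measurable borel" "f' \<in> borel_measurable borel"
      "g \<in> borel_measurable borel" "g' \<in> borel_measurable borel"
    and "AE x in lborel. f x = f' x" "AE x in lborel. g x = g' x"
  shows "L2_inner f g = L2_inner f' g'"
  unfolding L2_inner_def using assms(5,6)
  by (intro integral_cong_AE) (measurable, auto elim: eventually_elim2)

theorem fourier_parseval:
  assumes f: "f \<in> L2" and g: "g \<in> L2"
  shows "L2_inner (fourier f) (fourier g) = 2 * of_real pi * L2_inner f g"
proof -
  let ?g = "\<lambda>x. cnj (g (- x))"
  have gr: "?g \<in> L2" "fourier (fourier f) \<in> L2"
    by (intro L2_cnj L2_reflect L2_fourier f g)+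
  have [measurable]: "f \<in> borel_measurable borel" "g \<in> borel_measurable borel"
      "fourier f \<in> borel_measurable borel"
      "fourier g \<in> borel_measurable borel" "fourier (fourier f) \<in> borel_measurable borel"
      "fourier ?g \<in> borel_measurable borel"
    using f g gr by (auto intro: L2_measurable L2_fourier)
  have "AE \<xi> in lborel. cnj (fourier g \<xi>) = fourier ?g \<xi>"
    using fourier_reflect[OF L2_cnj[OF g]] AE_lborel_reflect[OF fourier_cnj[OF g]]
    by eventually_elim simp
  then have "L2_inner (fourier f) (fourier g) = (LINT \<xi>|lborel. fourier f \<xi> * fourier ?g \<xi>)"
    unfolding L2_inner_def by (intro integral_cong_AE) (measurable, auto elim: eventually_mono)
  also have "\<dots> = (LINT x|lborel. fourier (fourier f) x * ?g x)"
    by (rule fourier_multiplication[OF L2_fourier[OF f] gr(1), symmetric])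
  also have "\<dots> = (LINT x|lborel. fourier (fourier f) (- x) * cnj (g x))"
    using integral_lborel_reflect[of "\<lambda>x. fourier (fourier f) x * ?g x"] by simp
  also have "\<dots> = (LINT x|lborel. 2 * of_real pi * (f x * cnj (g x)))"
    using fourier_fourier[OF f] by (intro integral_cong_AE) (measurable, auto elim: eventually_mono)
  finally show ?thesis
    by (simp only: L2_inner_def integral_mult_right_zero)
qed

section \<open>Hardy spaces and the projector\<close>

lemma ess_support_subset_iff:
  assumes "closed S"
  shows "ess_support f \<subseteq> S \<longleftrightarrow> (AE x in lborel. x \<notin> S \<longrightarrow> f x = 0)"
proof
  let ?U = "{U. open U \<and> (AE x in lborel. x \<in> U \<longrightarrow> f x = 0)}"
  obtain V where V: "V \<subseteq> ?U" "countable V" "\<Union>V = \<Union>?U"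
    using Lindelof[of ?U] by (metis (no_types, lifting) mem_Collect_eq)
  then have "AE x in lborel. \<forall>U\<in>V. x \<in> U \<longrightarrow> f x = 0"
    by (subst AE_ball_countable) auto
  then have null: "AE x in lborel. x \<in> - ess_support f \<longrightarrow> f x = 0"
    unfolding ess_support_def double_complement V(3)[symmetric] by eventually_elim blast
  assume "ess_support f \<subseteq> S"
  with null show "AE x in lborel. x \<notin> S \<longrightarrow> f x = 0"
    by (auto elim!: eventually_mono)
next
  assume "AE x in lborel. x \<notin> S \<longrightarrow> f x = 0"
  then have "open (- S) \<and> (AE x in lborel. x \<in> - S \<longrightarrow> f x = 0)"
    using assms by auto
  then show "ess_support f \<subseteq> S"
    unfolding ess_support_def by blast
qed

lemma H_space_0: "H_space 0 = L2"
proof -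
  have "1 + \<xi>\<^sup>2 \<noteq> 0" for \<xi> :: real
    by (metis add_pos_nonneg less_irrefl zero_le_power2 zero_less_one)
  then show ?thesis
    using L2_fourier by (auto simp: H_space_def L2_def)
qed

lemma H_space_1_iff: "f \<in> H_space 1 \<longleftrightarrow> f \<in> L2 \<and> (\<lambda>\<xi>. of_real \<xi> * fourier f \<xi>) \<in> L2"
proof (cases "f \<in> L2")
  case True
  have F: "fourier f \<in> L2"
    by (rule L2_fourier[OF True])
  then have [measurable]: "fourier f \<in> borel_measurable borel"
    by (rule L2_measurable)
  have int: "integrable lborel (\<lambda>\<xi>. (cmod (fourier f \<xi>))\<^sup>2)"
    using F by (simp add: L2_def)
  have split: "(1 + \<xi>\<^sup>2) powr 1 * (cmod (fourier f \<xi>))\<^sup>2 =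
      (cmod (of_real \<xi> * fourier f \<xi>))\<^sup>2 + (cmod (fourier f \<xi>))\<^sup>2" for \<xi>
    by (simp add: norm_mult power_mult_distrib algebra_simps add_nonneg_nonneg)
  have "integrable lborel (\<lambda>\<xi>. (1 + \<xi>\<^sup>2) powr 1 * (cmod (fourier f \<xi>))\<^sup>2) \<longleftrightarrow>
      integrable lborel (\<lambda>\<xi>. (cmod (of_real \<xi> * fourier f \<xi>))\<^sup>2)"
    unfolding split
  proof
    assume "integrable lborel (\<lambda>\<xi>. (cmod (of_real \<xi> * fourier f \<xi>))\<^sup>2 + (cmod (fourier f \<xi>))\<^sup>2)"
    from Bochner_Integration.integrable_diff[OF this int]
    show "integrable lborel (\<lambda>\<xi>. (cmod (of_real \<xi> * fourier f \<xi>))\<^sup>2)"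
      by simp
  qed (rule Bochner_Integration.integrable_add[OF _ int])
  then show ?thesis
    using True unfolding H_space_def by (simp add: L2_def)
qed (simp add: H_space_def)

lemma H_plus_iff: "f \<in> H_plus \<sigma> \<longleftrightarrow> f \<in> H_space \<sigma> \<and> (AE \<xi> in lborel. \<xi> < 0 \<longrightarrow> fourier f \<xi> = 0)"
  by (simp add: H_plus_def ess_support_subset_iff not_le)

lemma H_plus_0_iff: "f \<in> H_plus 0 \<longleftrightarrow> f \<in> L2 \<and> (AE \<xi> in lborel. \<xi> < 0 \<longrightarrow> fourier f \<xi> = 0)"
  by (simp add: H_plus_iff H_space_0)

lemma H_plus_1_iff: "f \<in> H_plus 1 \<longleftrightarrow> f \<in> H_plus 0 \<and> (\<lambda>\<xi>. of_real \<xi> * fourier f \<xi>) \<in> L2"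
  by (auto simp: H_plus_iff H_space_0 H_space_1_iff)

lemma H_plus_1D:
  assumes "f \<in> H_plus 1"
  shows "f \<in> H_plus 0" "f \<in> H_space 1" "f \<in> L2"
  using assms by (simp_all add: H_plus_1_iff H_plus_0_iff H_space_1_iff)

lemma H_space_1_bounded:
  assumes "u \<in> H_space 1"
  shows "\<exists>B. AE x in lborel. cmod (u x) \<le> B"
proof -
  have u: "u \<in> L2" "(\<lambda>\<xi>. of_real \<xi> * fourier u \<xi>) \<in> L2"
    using assms by (auto simp: H_space_1_iff)
  have "(\<lambda>\<xi>. of_real \<xi> * fourier u \<xi> + \<i> * fourier u \<xi>) \<in> L2"
    by (intro L2_add L2_cmult L2_fourier u)
  from L2_mult_integrable[OF L2_inverse_add_ii this]
  have int: "integrable lborel (fourier u)"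
    by (simp add: mult.assoc[symmetric] flip: distrib_right)
  have "AE x in lborel. cmod (u x) \<le> cmod (1 / (2 * of_real pi)) *
      (LINT \<xi>|lborel. cmod (fourier u \<xi>))"
    using inv_fourier_fourier[OF u(1)] inv_fourier_eq_fourier_integral[OF L2_fourier[OF u(1)] int]
  proof eventually_elim
    case (elim x)
    then have "cmod (u x) = cmod (1 / (2 * of_real pi)) * cmod (fourier_integral (fourier u) (- x))"
      by (metis norm_mult)
    also have "\<dots> \<le> cmod (1 / (2 * of_real pi)) * (LINT \<xi>|lborel. cmod (fourier u \<xi>))"
      by (intro mult_left_mono norm_fourier_integral_le norm_ge_zero)
    finally show ?case .
  qed
  then show ?thesis by blast
qed

lemma L2_half_line: "f \<in> L2 \<Longrightarrow> (\<lambda>\<xi>. of_real (indicator {0..} \<xi>) * f \<xi>) \<in> L2"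
  by (rule L2_mult_bounded[where B = 1]) (auto simp: indicator_def)

lemma L2_szego: "f \<in> L2 \<Longrightarrow> szego f \<in> L2"
  unfolding szego_def[abs_def] by (intro L2_inv_fourier L2_half_line L2_fourier)

lemma fourier_szego:
  "f \<in> L2 \<Longrightarrow> AE \<xi> in lborel. fourier (szego f) \<xi> = of_real (indicator {0..} \<xi>) * fourier f \<xi>"
  unfolding szego_def[abs_def] by (intro fourier_inv_fourier L2_half_line L2_fourier)

lemma szego_in_H_plus_0:
  assumes "f \<in> L2"
  shows "szego f \<in> H_plus 0"
proof -
  have "AE \<xi> in lborel. \<xi> < 0 \<longrightarrow> fourier (szego f) \<xi> = 0"
    using fourier_szego[OF assms] by eventually_elim (simp add: indicator_def)
  then show ?thesis
    by (simp add: H_plus_0_iff L2_szego assms)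
qed

lemma szego_cong_AE:
  assumes "f \<in> borel_measurable borel" "g \<in> borel_measurable borel" "AE x in lborel. f x = g x"
  shows "szego f = szego g"
  by (simp add: szego_def fun_eq_iff fourier_cong_AE[OF assms])

lemma szego_add:
  assumes f: "f \<in> L2" and g: "g \<in> L2"
  shows "AE x in lborel. szego (\<lambda>x. f x + g x) x = szego f x + szego g x"
proof (rule AE_eq_if_fourier_AE_eq)
  show "AE \<xi> in lborel. fourier (szego (\<lambda>x. f x + g x)) \<xi> = fourier (\<lambda>x. szego f x + szego g x) \<xi>"
    using fourier_szego[OF L2_add[OF f g]] fourier_szego[OF f] fourier_szego[OF g]
      fourier_add[OF f g] fourier_add[OF L2_szego[OF f] L2_szego[OF g]]
    by eventually_elim (simp add: distrib_left)
qed (intro L2_szego L2_add f g)+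

lemma szego_cnj_H_plus_0:
  assumes "u \<in> H_plus 0"
  shows "AE x in lborel. szego (\<lambda>x. cnj (u x)) x = 0"
proof -
  have u: "u \<in> L2" "(\<lambda>x. cnj (u x)) \<in> L2" "AE \<xi> in lborel. \<xi> < 0 \<longrightarrow> fourier u \<xi> = 0"
    using assms by (auto simp: H_plus_0_iff intro: L2_cnj)
  have "AE x in lborel. szego (\<lambda>x. cnj (u x)) x = 0 * u x"
  proof (rule AE_eq_if_fourier_AE_eq[OF L2_szego[OF u(2)] L2_cmult[OF u(1)]])
    show "AE \<xi> in lborel. fourier (szego (\<lambda>x. cnj (u x))) \<xi> = fourier (\<lambda>x. 0 * u x) \<xi>"
      using fourier_szego[OF u(2)] fourier_cnj[OF u(1)] AE_lborel_reflect[OF u(3)]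
        fourier_cmult[OF u(1), of 0] AE_lborel_singleton[of 0]
      by eventually_elim (auto simp: indicator_def)
  qed
  then show ?thesis by simp
qed

text \<open>The transform of the product is a convolution of functions supported in \<open>[0, \<infinity>)\<close>.\<close>

lemma fourier_integral_mult_H_plus_0:
  assumes "u \<in> H_plus 0" "v \<in> H_plus 0" "\<xi> < 0"
  shows "fourier_integral (\<lambda>x. u x * v x) \<xi> = 0"
proof -
  have u: "u \<in> L2" "AE \<eta> in lborel. \<eta> < 0 \<longrightarrow> fourier u \<eta> = 0"
    and v: "v \<in> L2" "AE \<eta> in lborel. \<eta> < 0 \<longrightarrow> fourier v \<eta> = 0"
    using assms by (auto simp: H_plus_0_iff)
  let ?u = "\<lambda>x. cis (- (x * \<xi>)) * u x" and ?v = "\<lambda>\<eta>. inv_fourier v \<eta>"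
  have "fourier_integral (\<lambda>x. u x * v x) \<xi> = (LINT x|lborel. ?u x * v x)"
    by (simp add: fourier_integral_def mult_ac)
  also have "\<dots> = (LINT x|lborel. ?u x * fourier ?v x)"
    using fourier_inv_fourier[OF v(1)] measurable_fourier[OF L2_inv_fourier[OF v(1)]] u(1) v(1)
    by (intro integral_cong_AE) (measurable, auto elim: eventually_mono)
  also have "\<dots> = (LINT \<eta>|lborel. fourier ?u \<eta> * ?v \<eta>)"
    by (rule fourier_multiplication[symmetric]) (intro L2_modulate L2_inv_fourier u v)+
  also have "\<dots> = 0"
  proof (rule integral_eq_zero_AE)
    show "AE \<eta> in lborel. fourier ?u \<eta> * ?v \<eta> = 0"
      using fourier_modulate[OF u(1), of \<xi>] AE_lborel_shift[OF u(2), of \<xi>]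
        AE_lborel_reflect[OF v(2)]
    proof eventually_elim
      case (elim \<eta>)
      then show ?case
        using assms(3) by (cases "\<eta> > 0") (auto simp: inv_fourier_def)
    qed
  qed
  finally show ?thesis .
qed

lemma H_plus_0_mult:
  assumes "u \<in> H_plus 0" "v \<in> H_plus 0" "(\<lambda>x. u x * v x) \<in> L2"
  shows "(\<lambda>x. u x * v x) \<in> H_plus 0"
proof -
  have "integrable lborel (\<lambda>x. u x * v x)"
    using assms(1,2) by (auto simp: H_plus_0_iff intro: L2_mult_integrable)
  from fourier_eq_fourier_integral[OF assms(3) this]
  have "AE \<xi> in lborel. \<xi> < 0 \<longrightarrow> fourier (\<lambda>x. u x * v x) \<xi> = 0"
    by eventually_elim (simp add: fourier_integral_mult_H_plus_0 assms)
  then show ?thesis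
    using assms(3) by (simp add: H_plus_0_iff)
qed

lemma convolution_inv_fourier:
  assumes g: "g \<in> L2" and f: "f \<in> L2" and gF: "(\<lambda>\<xi>. g \<xi> * fourier f \<xi>) \<in> L2"
  shows "AE x in lborel. Defs.convolution (inv_fourier g) f x =
      inv_fourier (\<lambda>\<xi>. g \<xi> * fourier f \<xi>) x"
proof -
  have F: "fourier f \<in> L2" "fourier g \<in> L2" by (intro L2_fourier f g)+
  have [measurable]: "f \<in> borel_measurable borel" "fourier g \<in> borel_measurable borel"
      "g \<in> borel_measurable borel"
    using f g F by (auto intro: L2_measurable)
  have "Defs.convolution (inv_fourier g) f x =
      1 / (2 * of_real pi) * fourier_integral (\<lambda>\<xi>. g \<xi> * fourier f \<xi>) (- x)" for x
  proof -
    let ?g = "\<lambda>\<xi>. cis (- (\<xi> * - x)) * g \<xi>"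
    have [measurable]: "fourier ?g \<in> borel_measurable borel"
      by (rule measurable_fourier[OF L2_modulate[OF g]])
    have "Defs.convolution (inv_fourier g) f x =
        (LINT y|lborel. 1 / (2 * of_real pi) * (fourier g (- x + y) * f y))"
      unfolding Defs.convolution_def inv_fourier_def by (simp add: mult.assoc)
    also have "\<dots> = 1 / (2 * of_real pi) * (LINT y|lborel. fourier g (- x + y) * f y)"
      by (rule integral_mult_right_zero)
    also have "(LINT y|lborel. fourier g (- x + y) * f y) = (LINT y|lborel. fourier ?g y * f y)"
      using fourier_modulate[OF g, of "- x"]
      by (intro integral_cong_AE) (measurable, auto elim: eventually_mono)
    also have "\<dots> = (LINT \<xi>|lborel. ?g \<xi> * fourier f \<xi>)"
      by (rule fourier_multiplication[OF L2_modulate[OF g] f])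
    also have "\<dots> = fourier_integral (\<lambda>\<xi>. g \<xi> * fourier f \<xi>) (- x)"
      by (simp add: fourier_integral_def mult_ac)
    finally show ?thesis .
  qed
  then show ?thesis
    using inv_fourier_eq_fourier_integral[OF gF L2_mult_integrable[OF g F(1)]]
    by (auto elim: eventually_mono)
qed

section \<open>The Lax operator\<close>

lemma
  assumes "h \<in> H_space 1"
  shows L2_deriv_L2: "deriv_L2 h \<in> L2"
    and fourier_deriv_L2: "AE \<xi> in lborel. fourier (deriv_L2 h) \<xi> = \<i> * of_real \<xi> * fourier h \<xi>"
proof -
  have "(\<lambda>\<xi>. \<i> * of_real \<xi> * fourier h \<xi>) \<in> L2"
    using L2_cmult[of "\<lambda>\<xi>. of_real \<xi> * fourier h \<xi>" \<i>] assms by (simp add: H_space_1_iff mult.assoc)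
  then show "deriv_L2 h \<in> L2" "AE \<xi> in lborel. fourier (deriv_L2 h) \<xi> = \<i> * of_real \<xi> * fourier h \<xi>"
    unfolding deriv_L2_def[abs_def] by (rule L2_inv_fourier, rule fourier_inv_fourier)
qed

lemma fourier_momentum:
  assumes "h \<in> H_space 1"
  shows "AE \<xi> in lborel. fourier (\<lambda>x. - \<i> * deriv_L2 h x) \<xi> = of_real \<xi> * fourier h \<xi>"
  using fourier_cmult[OF L2_deriv_L2[OF assms], of "- \<i>"] fourier_deriv_L2[OF assms]
  by eventually_elim (simp add: mult.assoc[symmetric])

lemma L2_inner_real_multiplier:
  assumes L2: "f \<in> L2" "f' \<in> L2" "g \<in> L2" "g' \<in> L2"
    and f: "AE \<xi> in lborel. fourier f' \<xi> = of_real (m \<xi>) * fourier f \<xi>"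
    and g: "AE \<xi> in lborel. fourier g' \<xi> = of_real (m \<xi>) * fourier g \<xi>"
  shows "L2_inner f' g = L2_inner f g'"
proof -
  have [measurable]: "fourier f \<in> borel_measurable borel" "fourier f' \<in> borel_measurable borel"
      "fourier g \<in> borel_measurable borel" "fourier g' \<in> borel_measurable borel"
    by (intro measurable_fourier L2)+
  have "L2_inner (fourier f') (fourier g) = L2_inner (fourier f) (fourier g')"
    unfolding L2_inner_def using f g
    by (intro integral_cong_AE) (measurable, auto elim!: eventually_elim2 simp: mult_ac)
  then show ?thesis
    by (simp add: fourier_parseval L2)
qed

lemma szego_self_adjoint: "f \<in> L2 \<Longrightarrow> g \<in> L2 \<Longrightarrow> L2_inner (szego f) g = L2_inner f (szego g)"
  by (rule L2_inner_real_multiplier[OF _ _ _ _ fourier_szego fourier_szego])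
    (simp_all add: L2_szego)

lemma L2_inner_diff_left:
  assumes "f \<in> L2" "g \<in> L2" "h \<in> L2"
  shows "L2_inner (\<lambda>x. f x - g x) h = L2_inner f h - L2_inner g h"
  using L2_mult_integrable[OF assms(1) L2_cnj[OF assms(3)]]
    L2_mult_integrable[OF assms(2) L2_cnj[OF assms(3)]]
  by (simp add: L2_inner_def left_diff_distrib)

lemma L2_inner_commute: "L2_inner g f = cnj (L2_inner f g)"
  by (simp add: L2_inner_def mult.commute flip: Bochner_Integration.integral_cnj)

lemma L2_inner_cmult_left: "L2_inner (\<lambda>x. c * f x) g = c * L2_inner f g"
  by (simp add: L2_inner_def mult.assoc)

lemma L2_inner_diff_right:
  assumes "f \<in> L2" "g \<in> L2" "h \<in> L2"
  shows "L2_inner h (\<lambda>x. f x - g x) = L2_inner h f - L2_inner h g"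
  using L2_inner_diff_left[OF assms] L2_inner_commute[of h] by simp

lemma L2_inner_self_eq_0_iff:
  assumes "f \<in> L2"
  shows "L2_inner f f = 0 \<longleftrightarrow> (AE x in lborel. f x = 0)"
proof -
  have "L2_inner f f = (LINT x|lborel. complex_of_real ((cmod (f x))\<^sup>2))"
    by (simp add: L2_inner_def complex_norm_square[unfolded of_real_power])
  also have "\<dots> = of_real (LINT x|lborel. (cmod (f x))\<^sup>2)"
    by (rule Bochner_Integration.integral_complex_of_real)
  finally show ?thesis
    using assms by (simp add: L2_def integral_nonneg_eq_0_iff_AE)
qed

lemma L2_potential:
  assumes "u \<in> borel_measurable borel" "AE x in lborel. cmod (u x) \<le> B" "h \<in> L2"
  shows "(\<lambda>x. u x * szego (\<lambda>y. cnj (u y) * h y) x) \<in> L2"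
  using assms by (intro L2_mult_bounded[where B = B] L2_szego) simp_all

lemma lax_symmetric:
  assumes u: "u \<in> borel_measurable borel" "AE x in lborel. cmod (u x) \<le> B"
    and f: "f \<in> H_space 1" and g: "g \<in> H_space 1"
  shows "L2_inner (lax u f) g = L2_inner f (lax u g)"
proof -
  let ?D = "\<lambda>h x. - \<i> * deriv_L2 h x" and ?V = "\<lambda>h x. u x * szego (\<lambda>y. cnj (u y) * h y) x"
  have fg: "f \<in> L2" "g \<in> L2"
    using f g by (auto simp: H_space_1_iff)
  have D: "?D f \<in> L2" "?D g \<in> L2"
    by (intro L2_cmult L2_deriv_L2 f g)+
  have V: "?V f \<in> L2" "?V g \<in> L2"
    by (intro L2_potential[OF u] fg)+
  have cnj_u: "(\<lambda>x. cnj (u x) * f x) \<in> L2" "(\<lambda>x. cnj (u x) * g x) \<in> L2"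
    using u by (intro L2_mult_bounded[where B = B] fg; simp)+
  have momentum: "L2_inner (?D f) g = L2_inner f (?D g)"
    by (rule L2_inner_real_multiplier
        [OF fg(1) D(1) fg(2) D(2) fourier_momentum[OF f] fourier_momentum[OF g]])
  have "L2_inner (?V f) g = L2_inner (szego (\<lambda>y. cnj (u y) * f y)) (\<lambda>x. cnj (u x) * g x)"
    by (simp add: L2_inner_def mult_ac)
  also have "\<dots> = L2_inner (\<lambda>x. cnj (u x) * f x) (szego (\<lambda>y. cnj (u y) * g y))"
    by (rule szego_self_adjoint[OF cnj_u])
  also have "\<dots> = L2_inner f (?V g)"
    by (simp add: L2_inner_def mult_ac)
  finally show ?thesis
    unfolding lax_def[abs_def] L2_inner_diff_left[OF D(1) V(1) fg(2)]
      L2_inner_diff_right[OF D(2) V(2) fg(1)]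
    by (simp only: momentum)
qed

lemma sigma_pp_subset_Reals:
  assumes u: "u \<in> borel_measurable borel" "AE x in lborel. cmod (u x) \<le> B"
  shows "sigma_pp u \<subseteq> \<real>"
proof
  fix \<mu> assume "\<mu> \<in> sigma_pp u"
  then obtain h where h: "h \<in> H_space 1" "\<not> (AE x in lborel. h x = 0)"
    and eigen: "AE x in lborel. lax u h x = \<mu> * h x"
    by (auto simp: sigma_pp_def H_plus_iff)
  have "h \<in> L2"
    using h(1) by (simp add: H_space_1_iff)
  moreover have "lax u h \<in> L2"
    unfolding lax_def[abs_def]
    by (intro L2_diff L2_cmult L2_deriv_L2 L2_potential[OF u] h(1) \<open>h \<in> L2\<close>)
  ultimately have L2: "h \<in> L2" "lax u h \<in> L2" .
  have "L2_inner (lax u h) h = \<mu> * L2_inner h h"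
    using eigen L2 L2_cmult[OF L2(1), of \<mu>] unfolding L2_inner_cmult_left[symmetric]
    by (intro L2_inner_cong_AE) (auto intro: L2_measurable)
  moreover have "L2_inner (lax u h) h = cnj (L2_inner (lax u h) h)"
    by (subst (2) lax_symmetric[OF u h(1) h(1)], rule L2_inner_commute)
  moreover have "L2_inner h h = cnj (L2_inner h h)"
    by (rule L2_inner_commute)
  ultimately have "\<mu> * L2_inner h h = cnj \<mu> * L2_inner h h"
    by (metis complex_cnj_mult)
  moreover have "L2_inner h h \<noteq> 0"
    using h(2) L2 by (simp add: L2_inner_self_eq_0_iff)
  ultimately show "\<mu> \<in> \<real>"
    by (simp add: Reals_cnj_iff)
qed

section \<open>The resolvent of the free operator\<close>

lemma norm_add_ii_le_norm_diff:
  assumes "k \<notin> \<real>\<^sub>\<ge>\<^sub>0"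
  shows "\<exists>C\<ge>0. \<forall>\<xi>\<ge>0. cmod (of_real \<xi> + \<i>) \<le> C * cmod (of_real \<xi> - k)"
proof -
  obtain d where d: "d > 0" "\<And>z. z \<in> \<real>\<^sub>\<ge>\<^sub>0 \<Longrightarrow> d \<le> dist k z"
    using separate_point_closed[OF closed_nonneg_Reals_complex assms] by blast
  have "cmod (of_real \<xi> + \<i>) \<le> (1 + cmod (k + \<i>) / d) * cmod (of_real \<xi> - k)" if "\<xi> \<ge> 0" for \<xi>
  proof -
    have "d \<le> cmod (of_real \<xi> - k)"
      using d(2)[of "of_real \<xi>"] that by (simp add: dist_norm norm_minus_commute)
    then have "cmod (k + \<i>) * 1 \<le> cmod (k + \<i>) * (cmod (of_real \<xi> - k) / d)"
      using d(1) by (intro mult_left_mono) auto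
    moreover have "cmod (of_real \<xi> + \<i>) \<le> cmod (of_real \<xi> - k) + cmod (k + \<i>)"
      using norm_triangle_ineq[of "of_real \<xi> - k" "k + \<i>"] by simp
    ultimately show ?thesis
      by (simp add: algebra_simps)
  qed
  moreover have "1 + cmod (k + \<i>) / d \<ge> 0"
    using d(1) by simp
  ultimately show ?thesis by blast
qed

definition resolvent_symbol :: "complex \<Rightarrow> real \<Rightarrow> complex" where
  "resolvent_symbol k \<xi> = of_real (indicator {0..} \<xi>) / (of_real \<xi> - k)"

lemma G_eq: "G k = inv_fourier (resolvent_symbol k)"
  by (simp add: G_def resolvent_symbol_def[abs_def])

lemma
  assumes "k \<notin> \<real>\<^sub>\<ge>\<^sub>0"
  shows L2_resolvent_symbol: "resolvent_symbol k \<in> L2"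
    and resolvent_symbol_bounded: "\<exists>B. \<forall>\<xi>. cmod (resolvent_symbol k \<xi>) \<le> B"
proof -
  obtain C where "C \<ge> 0" and C: "\<And>\<xi>. \<xi> \<ge> 0 \<Longrightarrow> cmod (of_real \<xi> + \<i>) \<le> C * cmod (of_real \<xi> - k)"
    using norm_add_ii_le_norm_diff[OF assms] by blast
  have symbol_le: "cmod (resolvent_symbol k \<xi>) \<le> C * cmod (inverse (of_real \<xi> + \<i>))" for \<xi>
  proof (cases "\<xi> \<ge> 0")
    case True
    then have "of_real \<xi> - k \<noteq> 0"
      using assms by auto
    then have "1 / cmod (of_real \<xi> - k) \<le> C / cmod (of_real \<xi> + \<i>)"
      using C[OF True] by (simp add: divide_le_eq pos_le_divide_eq mult.commute)
    then show ?thesis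
      using True by (simp add: resolvent_symbol_def norm_divide norm_inverse divide_inverse)
  next
    case False
    then show ?thesis
      using \<open>C \<ge> 0\<close> by (simp add: resolvent_symbol_def)
  qed
  have "resolvent_symbol k \<in> borel_measurable borel"
    unfolding resolvent_symbol_def[abs_def] by measurable
  then show "resolvent_symbol k \<in> L2"
    using symbol_le by (intro L2_dominated[OF L2_inverse_add_ii, of _ C]) auto
  have "cmod (inverse (of_real \<xi> + \<i>)) \<le> 1" for \<xi>
    using abs_Im_le_cmod[of "of_real \<xi> + \<i>"] by (simp add: norm_inverse inverse_le_1_iff)
  then have "cmod (resolvent_symbol k \<xi>) \<le> C" for \<xi>
    using symbol_le[of \<xi>] mult_left_mono[OF _ \<open>C \<ge> 0\<close>, of "cmod (inverse (of_real \<xi> + \<i>))" 1]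
    by simp
  then show "\<exists>B. \<forall>\<xi>. cmod (resolvent_symbol k \<xi>) \<le> B" by blast
qed

lemma resolvent_symbol_equation:
  assumes "k \<notin> \<real>\<^sub>\<ge>\<^sub>0" "\<xi> < 0 \<longrightarrow> z = 0"
  shows "of_real \<xi> * (resolvent_symbol k \<xi> * z) = k * (resolvent_symbol k \<xi> * z) + z"
proof (cases "\<xi> \<ge> 0")
  case True
  then have "of_real \<xi> - k \<noteq> 0"
    using assms(1) by auto
  then show ?thesis
    using True by (simp add: resolvent_symbol_def field_simps)
qed (use assms(2) in simp)

lemma convolution_G:
  assumes k: "k \<notin> \<real>\<^sub>\<ge>\<^sub>0" and f: "f \<in> H_plus 0"
  obtains w where "w \<in> H_plus 1" "AE x in lborel. Defs.convolution (G k) f x = w x"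
    "AE x in lborel. - \<i> * deriv_L2 w x = k * w x + f x"
proof -
  let ?g = "resolvent_symbol k"
  obtain B where B: "\<And>\<xi>. cmod (?g \<xi>) \<le> B"
    using resolvent_symbol_bounded[OF k] by blast
  note g = L2_resolvent_symbol[OF k]
  have f0: "f \<in> L2" "AE \<xi> in lborel. \<xi> < 0 \<longrightarrow> fourier f \<xi> = 0"
    using f by (auto simp: H_plus_0_iff)
  have gf: "(\<lambda>\<xi>. ?g \<xi> * fourier f \<xi>) \<in> L2"
    by (rule L2_mult_bounded[OF L2_fourier[OF f0(1)] L2_measurable[OF g] AE_I2[OF B]])
  define w where "w = inv_fourier (\<lambda>\<xi>. ?g \<xi> * fourier f \<xi>)"
  have w: "w \<in> L2" "AE \<xi> in lborel. fourier w \<xi> = ?g \<xi> * fourier f \<xi>"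
    unfolding w_def by (rule L2_inv_fourier[OF gf], rule fourier_inv_fourier[OF gf])
  have kwf: "(\<lambda>x. k * w x + f x) \<in> L2"
    by (intro L2_add L2_cmult w f0)
  have equation: "AE \<xi> in lborel. of_real \<xi> * fourier w \<xi> = fourier (\<lambda>x. k * w x + f x) \<xi>"
    using w(2) f0(2) fourier_add[OF L2_cmult[OF w(1)] f0(1), of k] fourier_cmult[OF w(1), of k]
    by eventually_elim (simp add: resolvent_symbol_equation[OF k])
  have "w \<in> H_plus 0"
    using w f0(2) by (auto simp: H_plus_0_iff elim: eventually_elim2)
  moreover have "(\<lambda>\<xi>. of_real \<xi> * fourier w \<xi>) \<in> L2"
    using equation by (intro L2_cong_AE[OF L2_fourier[OF kwf]])
      (auto intro!: borel_measurable_times measurable_fourier[OF w(1)] elim: eventually_mono)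
  ultimately have w_plus: "w \<in> H_plus 1"
    by (simp add: H_plus_1_iff)
  note w_H1 = H_plus_1D(2)[OF w_plus]
  have "AE x in lborel. - \<i> * deriv_L2 w x = k * w x + f x"
  proof (rule AE_eq_if_fourier_AE_eq[OF _ kwf])
    show "AE \<xi> in lborel. fourier (\<lambda>x. - \<i> * deriv_L2 w x) \<xi> = fourier (\<lambda>x. k * w x + f x) \<xi>"
      using fourier_momentum[OF w_H1] equation by eventually_elim simp
  qed (intro L2_cmult L2_deriv_L2 w_H1)
  moreover have "AE x in lborel. Defs.convolution (G k) f x = w x"
    unfolding G_eq w_def by (rule convolution_inv_fourier[OF g f0(1) gf])
  ultimately show thesis
    using w_plus that by blast
qed

section \<open>The integral equation\<close>

text \<open>In the definition of \<open>Linf_weighted\<close> the weight is a power of complex numbers.\<close>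

lemma Linf_weighted_iff:
  "f \<in> Linf_weighted r \<longleftrightarrow> f \<in> borel_measurable borel \<and>
    (\<exists>C. AE x in lborel. (1 + x\<^sup>2) powr (r / 2) * cmod (f x) \<le> C)"
proof -
  have "cmod ((1 + (complex_of_real x)\<^sup>2) powr (of_real r / 2)) = (1 + x\<^sup>2) powr (r / 2)" for x
  proof -
    have "(1 + (complex_of_real x)\<^sup>2) powr (of_real r / 2) = of_real ((1 + x\<^sup>2) powr (r / 2))"
      using powr_of_real[of "1 + x\<^sup>2" "r / 2"] by simp
    then show ?thesis by simp
  qed
  then show ?thesis
    by (simp add: Linf_weighted_def norm_mult)
qed

lemma L2_mult_weighted:
  assumes f: "f \<in> L2_weighted s" and \<phi>: "\<phi> \<in> Linf_weighted (- s)"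
  shows "(\<lambda>x. f x * \<phi> x) \<in> L2"
proof -
  have [measurable]: "f \<in> borel_measurable borel" "\<phi> \<in> borel_measurable borel"
    using f \<phi> by (auto simp: L2_weighted_def Linf_weighted_iff)
  let ?W = "\<lambda>r x. complex_of_real ((1 + x\<^sup>2) powr r)"
  have "(cmod (?W (s / 2) x * f x))\<^sup>2 = (cmod (f x))\<^sup>2 * (1 + x\<^sup>2) powr s" for x
    by (simp add: norm_mult power_mult_distrib power2_eq_square flip: powr_add)
  then have Wf: "(\<lambda>x. ?W (s / 2) x * f x) \<in> L2"
    using f by (simp add: L2_def L2_weighted_def)
  obtain C where "AE x in lborel. cmod (?W (- s / 2) x * \<phi> x) \<le> C"
    using \<phi> by (auto simp: Linf_weighted_iff norm_mult)
  then have "(\<lambda>x. ?W (- s / 2) x * \<phi> x * (?W (s / 2) x * f x)) \<in> L2"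
    by (intro L2_mult_bounded[OF Wf]) measurable
  moreover have "?W (- s / 2) x * \<phi> x * (?W (s / 2) x * f x) = f x * \<phi> x" for x
  proof -
    have "1 + x\<^sup>2 > 0"
      by (simp add: add_pos_nonneg)
    then have "(1 + x\<^sup>2) powr (- s / 2) * (1 + x\<^sup>2) powr (s / 2) = 1"
      by (simp flip: powr_add)
    then have "?W (- s / 2) x * ?W (s / 2) x = 1"
      by (simp flip: of_real_mult)
    moreover have "?W (- s / 2) x * \<phi> x * (?W (s / 2) x * f x) =
        ?W (- s / 2) x * ?W (s / 2) x * (f x * \<phi> x)"
      by (simp only: mult_ac)
    ultimately show ?thesis
      by (simp only: mult_1)
  qed
  ultimately show ?thesis by (simp only:)
qed

lemma is_solution_1:
  assumes "s \<ge> 0" and u: "u \<in> H_plus 0"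
  shows "is_solution u s k (\<lambda>x. 1)"
proof -
  have "AE y in lborel. u y * szego (\<lambda>x. cnj (u x)) y = 0"
    using szego_cnj_H_plus_0[OF u] by eventually_elim simp
  then have "Defs.convolution (G k) (\<lambda>y. u y * szego (\<lambda>x. cnj (u x)) y) x = 0" for x
    unfolding Defs.convolution_def by (intro integral_eq_zero_AE) (auto elim: eventually_mono)
  moreover have "(\<lambda>x. 1) \<in> Linf_weighted (- s)"
  proof -
    have "(1 + x\<^sup>2) powr (- s / 2) \<le> 1" for x :: real
      using powr_mono[of "- s / 2" 0 "1 + x\<^sup>2"] assms(1) by (simp add: powr_def split: if_splits)
    then show ?thesis
      unfolding Linf_weighted_iff by (intro conjI exI[of _ 1] AE_I2) simp_all
  qed
  ultimately show ?thesis
    by (simp add: is_solution_def)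
qed

lemma is_solution_unique:
  assumes u: "u \<in> H_plus 1" "u \<in> L2_weighted s"
    and k: "k \<notin> \<real>\<^sub>\<ge>\<^sub>0" "k \<notin> sigma_pp u" and sol: "is_solution u s k \<phi>"
  shows "AE x in lborel. \<phi> x = 1"
proof -
  note u_plus = H_plus_1D[OF u(1)]
  obtain B where B: "AE x in lborel. cmod (u x) \<le> B"
    using H_space_1_bounded[OF u_plus(2)] by blast
  have \<phi>: "\<phi> \<in> Linf_weighted (- s)"
    using sol by (simp add: is_solution_def)
  have "(\<lambda>x. cnj (u x)) \<in> L2_weighted s"
    using u(2) L2_measurable[OF L2_cnj[OF u_plus(3)]] by (simp add: L2_weighted_def)
  from L2_mult_weighted[OF this \<phi>] have cnj_u_\<phi>: "(\<lambda>x. cnj (u x) * \<phi> x) \<in> L2" .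
  define f where "f x = u x * szego (\<lambda>z. cnj (u z) * \<phi> z) x" for x
  have "f \<in> H_plus 0"
    unfolding f_def using B u_plus
    by (intro H_plus_0_mult szego_in_H_plus_0 cnj_u_\<phi> L2_mult_bounded[where B = B] L2_szego) auto
  from convolution_G[OF k(1) this] obtain w
    where w: "w \<in> H_plus 1" "AE x in lborel. Defs.convolution (G k) f x = w x"
      and resolvent: "AE x in lborel. - \<i> * deriv_L2 w x = k * w x + f x" .
  have "w \<in> L2"
    by (rule H_plus_1D[OF w(1)])
  have \<phi>_eq: "AE x in lborel. \<phi> x = 1 + w x"
    using sol w(2) unfolding is_solution_def f_def by (auto elim: eventually_elim2)
  have cnj_u_w: "(\<lambda>x. cnj (u x) * w x) \<in> L2"
    using B u_plus by (intro L2_mult_bounded[OF \<open>w \<in> L2\<close>, where B = B]) (auto dest: L2_measurable)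
  have szego_eq: "szego (\<lambda>x. cnj (u x) * \<phi> x) = szego (\<lambda>x. cnj (u x) + cnj (u x) * w x)"
    using \<phi>_eq cnj_u_\<phi> L2_add[OF L2_cnj[OF u_plus(3)] cnj_u_w]
    by (intro szego_cong_AE) (auto intro: L2_measurable elim!: eventually_mono simp: distrib_left)
  have "AE x in lborel. szego (\<lambda>x. cnj (u x) * \<phi> x) x = szego (\<lambda>x. cnj (u x) * w x) x"
    using szego_add[OF L2_cnj[OF u_plus(3)] cnj_u_w] szego_cnj_H_plus_0[OF u_plus(1)]
    unfolding szego_eq by eventually_elim simp
  with resolvent have "AE x in lborel. lax u w x = k * w x"
    by eventually_elim (simp add: lax_def f_def)
  then have "AE x in lborel. w x = 0"
    using k(2) w(1) unfolding sigma_pp_def by blast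
  with \<phi>_eq show ?thesis
    by eventually_elim simp
qed

theorem proposition1p9:
  fixes u :: "real \<Rightarrow> complex" and s :: real
  assumes "s > 1 / 2"
    and "u \<in> H_plus 1 \<inter> L2_weighted s"
  shows "\<forall>k \<in> {z. Im z > 0} \<union> {z. Im z < 0} \<union> (complex_of_real ` {..<0} - sigma_pp u).
           is_solution u s k (\<lambda>x. 1) \<and>
           (\<forall>\<phi>. is_solution u s k \<phi> \<longrightarrow> (AE x in lborel. \<phi> x = 1))"
proof
  fix k assume k: "k \<in> {z. Im z > 0} \<union> {z. Im z < 0} \<union> (complex_of_real ` {..<0} - sigma_pp u)"
  have u: "u \<in> H_plus 1" "u \<in> L2_weighted s"
    using assms(2) by auto
  note u_plus = H_plus_1D[OF u(1)]
  have "sigma_pp u \<subseteq> \<real>"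
    using sigma_pp_subset_Reals[OF L2_measurable[OF u_plus(3)]] H_space_1_bounded[OF u_plus(2)]
    by blast
  then have "k \<notin> sigma_pp u" and "k \<notin> \<real>\<^sub>\<ge>\<^sub>0"
    using k by (auto simp: complex_is_Real_iff complex_nonneg_Reals_iff subset_iff)
  then show "is_solution u s k (\<lambda>x. 1) \<and> (\<forall>\<phi>. is_solution u s k \<phi> \<longrightarrow> (AE x in lborel. \<phi> x = 1))"
    using is_solution_1[OF _ u_plus(1)] is_solution_unique[OF u] assms(1) by auto
qed

end
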